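(* Let $p$ be an odd prime. Given $$D=\frac{1-p^m}{(1-p)^2}\cdot p^2$$ for any integer $m\ge 2$, let $\sqrt{D}\in\mathbb{Q}_p$ denote the square root of $D$ satisfying $\sqrt{D}\equiv p \pmod{p^2}$. Then the Browkin II continued fraction expansion of $\pm\sqrt{D}$ in $\mathbb{Q}_p$ is $$\pm\sqrt{D}=\left[0,\ \pm\frac{1}{p},\ \overline{\mp 1,\ \mp\frac{2(p^{m-1}-1)}{(p-1)p^{m-1}},\ \mp 1,\ \pm\frac{2}{p}}\right],$$ with either the upper signs throughout or the lower signs throughout.
   Context: Let $p$ be an odd prime, and let $v_p$ be the $p$-adic valuation on $\mathbb{Q}_p$. Every $\alpha\in\mathbb{Q}_p$ is written as $\alpha=\sum_{n=-r}^{+\infty}a_np^n$ with $r\in\mathbb{Z}$ and digits $a_n\in\{-\frac{p-1}{2},\ldots,\frac{p-1}{2}\}$. Define $s(\alpha)=\sum_{n=-r}^{0}a_np^n\in\mathbb{Q}$ and $t(\alpha)=\sum_{n=-r}^{-1}a_np^n\in\mathbb{Q}$ (empty sums are $0$), and let $\mathrm{sign}$ be the usual sign function on $\mathbb{Q}$. The algorithm Browkin II, started at $\alpha_0=\alpha\in\mathbb{Q}_p$, computes for $n\ge 0$: $b_n=s(\alpha_n)$ if $n$ is even; $b_n=t(\alpha_n)$ if $n$ is odd and $v_p(\alpha_n-t(\alpha_n))=0$; $b_n=t(\alpha_n)-\mathrm{sign}(t(\alpha_n))$ if $n$ is odd and $v_p(\alpha_n-t(\alpha_n))\neq 0$; and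 $\alpha_{n+1}=\frac{1}{\alpha_n-b_n}$ (stopping if $\alpha_n=b_n$). The sequence $[b_0,b_1,\ldots]$ is the Browkin II continued fraction expansion of $\alpha$. The notation $[b_0,\ldots,b_{h-1},\overline{b_h,\ldots,b_{h+k-1}}]$ denotes the infinite continued fraction $[b_0,b_1,b_2,\ldots]$ with $b_{n+k}=b_n$ for all $n\ge h$; its value is the limit in $\mathbb{Q}_p$ of the convergents $[b_0,\ldots,b_n]=b_0+\cfrac{1}{b_1+\cfrac{1}{\ddots+\frac{1}{b_n}}}$.
   Formalization: For p = 3 the listed quotients are not the Browkin II output (for m = 2, D = -18, the algorithm gives b_3 = 1/3, not -2/3), so the claim about the algorithm is made only for p ≠ 3; for p = 3 only the root and the value of the continued fraction are asserted. *)

theory Defs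
  imports "HOL-Analysis.Analysis" "Berlekamp_Zassenhaus.Finite_Field"
begin

section \<open>The p-adic absolute value on the rationals\<close>

definition rat_val :: "nat \<Rightarrow> rat \<Rightarrow> int" where
  "rat_val p x = (let (a, b) = quotient_of x in
     int (multiplicity (int p) a) - int (multiplicity (int p) b))"

definition rat_abs :: "nat \<Rightarrow> rat \<Rightarrow> real" where
  "rat_abs p x = (if x = 0 then 0 else real p powi (- rat_val p x))"

definition padic_Cauchy :: "nat \<Rightarrow> (nat \<Rightarrow> rat) \<Rightarrow> bool" where
  "padic_Cauchy p X \<longleftrightarrow> (\<forall>e>0. \<exists>N. \<forall>m\<ge>N. \<forall>n\<ge>N. rat_abs p (X m - X n) < e)"

definition padic_rel :: "nat \<Rightarrow> (nat \<Rightarrow> rat) \<Rightarrow> (nat \<Rightarrow> rat) \<Rightarrow> bool" where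
  "padic_rel p X Y \<longleftrightarrow> padic_Cauchy p X \<and> padic_Cauchy p Y \<and>
     (\<lambda>n. rat_abs p (X n - Y n)) \<longlonglongrightarrow> 0"

context
  fixes p :: nat
  assumes p: "prime p"
begin

lemma p_gt_1: "real p > 1"
  using prime_gt_1_nat[OF p] by simp

lemma prime_elem_p: "prime_elem (int p)"
  using p by (simp add: prime_imp_prime_elem)

lemma rat_val_Fract:
  assumes "a \<noteq> 0" "b \<noteq> 0"
  shows "rat_val p (of_int a / of_int b) = int (multiplicity (int p) a) - int (multiplicity (int p) b)"
proof -
  obtain c d where cd: "quotient_of (of_int a / of_int b) = (c, d)"
    by (cases "quotient_of (of_int a / of_int b)")
  have d: "d > 0" using quotient_of_denom_pos[OF cd] .
  have eq: "(of_int a / of_int b :: rat) = of_int c / of_int d"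
    using quotient_of_div[OF cd] .
  hence "of_int (a * d) = (of_int (c * b) :: rat)"
    using assms d by (simp add: field_simps)
  hence ad: "a * d = c * b" by (simp only: of_int_eq_iff)
  have c: "c \<noteq> 0" using ad assms d by auto
  have "multiplicity (int p) a + multiplicity (int p) d = multiplicity (int p) c + multiplicity (int p) b"
    using arg_cong[OF ad, of "multiplicity (int p)"] assms c d prime_elem_p
    by (simp add: prime_elem_multiplicity_mult_distrib)
  thus ?thesis unfolding rat_val_def cd by simp
qed

lemma rat_cases:
  obtains a b where "b \<noteq> 0" "(x::rat) = of_int a / of_int b"
proof -
  obtain c d where cd: "quotient_of x = (c, d)" by (cases "quotient_of x")
  show ?thesis
    using that[of d c] quotient_of_denom_pos[OF cd] quotient_of_div[OF cd] by auto
qed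

lemma rat_val_mult:
  assumes "x \<noteq> 0" "y \<noteq> 0"
  shows "rat_val p (x * y) = rat_val p x + rat_val p y"
proof -
  obtain a b where ab: "b \<noteq> 0" "x = of_int a / of_int b" by (rule rat_cases)
  obtain c d where cd: "d \<noteq> 0" "y = of_int c / of_int d" by (rule rat_cases)
  have nz: "a \<noteq> 0" "c \<noteq> 0" using ab cd assms by auto
  have "x * y = of_int (a * c) / of_int (b * d)" using ab cd by simp
  hence "rat_val p (x * y) = int (multiplicity (int p) (a*c)) - int (multiplicity (int p) (b*d))"
    using rat_val_Fract[of "a*c" "b*d"] nz ab cd by simp
  thus ?thesis
    using nz ab cd rat_val_Fract[of a b] rat_val_Fract[of c d] prime_elem_p
    by (simp add: prime_elem_multiplicity_mult_distrib)
qed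

lemma rat_val_add:
  assumes "x \<noteq> 0" "y \<noteq> 0" "x + y \<noteq> 0"
  shows "rat_val p (x + y) \<ge> min (rat_val p x) (rat_val p y)"
proof -
  obtain a b where ab: "b \<noteq> 0" "x = of_int a / of_int b" by (rule rat_cases)
  obtain c d where cd: "d \<noteq> 0" "y = of_int c / of_int d" by (rule rat_cases)
  define u v w where uvw: "u = a * d" "v = c * b" "w = b * d"
  have w: "w \<noteq> 0" using ab cd uvw by simp
  have x: "x = of_int u / of_int w" and y: "y = of_int v / of_int w"
    using ab cd uvw by simp_all
  have xy: "x + y = of_int (u + v) / of_int w" by (simp add: x y add_divide_distrib)
  have nz: "u \<noteq> 0" "v \<noteq> 0" "u + v \<noteq> 0"
    using assms xy unfolding x y by auto
  define k where "k = min (multiplicity (int p) u) (multiplicity (int p) v)"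
  have "int p ^ k dvd u" "int p ^ k dvd v"
    by (auto simp: k_def intro!: multiplicity_dvd')
  hence dvd: "int p ^ k dvd u + v" by (rule dvd_add)
  have "\<not> is_unit (int p)" using prime_elem_p prime_elem_not_unit by blast
  hence "k \<le> multiplicity (int p) (u + v)"
    by (rule multiplicity_geI[OF nz(3) _ dvd])
  thus ?thesis
    unfolding xy unfolding x y rat_val_Fract[OF nz(1) w] rat_val_Fract[OF nz(2) w] rat_val_Fract[OF nz(3) w]
    by (simp add: k_def)
qed

lemma rat_abs_0 [simp]: "rat_abs p 0 = 0"
  by (simp add: rat_abs_def)

lemma rat_abs_nonneg [simp]: "rat_abs p x \<ge> 0"
  using p_gt_1 by (simp add: rat_abs_def)

lemma rat_abs_eq_0_iff [simp]: "rat_abs p x = 0 \<longleftrightarrow> x = 0"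
  using p_gt_1 by (auto simp: rat_abs_def)

lemma rat_abs_1 [simp]: "rat_abs p 1 = 1"
  by (simp add: rat_abs_def rat_val_def)

lemma rat_abs_mult: "rat_abs p (x * y) = rat_abs p x * rat_abs p y"
  using p_gt_1 by (auto simp: rat_abs_def rat_val_mult power_int_add[symmetric] add.commute)

lemma rat_abs_minus [simp]: "rat_abs p (- x) = rat_abs p x"
proof -
  have "rat_abs p (-1) * rat_abs p (-1) = 1"
    using rat_abs_mult[of "-1" "-1"] by simp
  hence "(rat_abs p (-1))\<^sup>2 = 1\<^sup>2" by (simp add: power2_eq_square)
  hence "rat_abs p (-1) = 1" by (rule power2_eq_imp_eq) auto
  thus ?thesis using rat_abs_mult[of "-1" x] by simp
qed

lemma rat_abs_minus_commute: "rat_abs p (x - y) = rat_abs p (y - x)"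
  using rat_abs_minus[of "x - y"] by simp

lemma rat_abs_ultra: "rat_abs p (x + y) \<le> max (rat_abs p x) (rat_abs p y)"
proof (cases "x = 0 \<or> y = 0 \<or> x + y = 0")
  case True
  thus ?thesis by (auto simp: le_max_iff_disj)
next
  case False
  hence "- rat_val p (x + y) \<le> - rat_val p x \<or> - rat_val p (x + y) \<le> - rat_val p y"
    using rat_val_add[of x y] by linarith
  thus ?thesis
    using False p_gt_1 unfolding le_max_iff_disj
    by (auto simp: rat_abs_def intro: power_int_increasing)
qed

lemma rat_abs_triangle: "rat_abs p (x + y) \<le> rat_abs p x + rat_abs p y"
  using rat_abs_ultra[of x y] rat_abs_nonneg[of x] rat_abs_nonneg[of y] by linarith

lemma rat_abs_inverse: "rat_abs p (inverse x) = inverse (rat_abs p x)"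
proof (cases "x = 0")
  case False
  have "rat_abs p x * rat_abs p (inverse x) = 1"
    using False rat_abs_mult[of x "inverse x"] by simp
  thus ?thesis by (metis inverse_unique)
qed simp

lemma rat_abs_diff_abs: "\<bar>rat_abs p x - rat_abs p y\<bar> \<le> rat_abs p (x - y)"
  using rat_abs_triangle[of y "x - y"] rat_abs_triangle[of x "y - x"]
    rat_abs_minus_commute[of x y] by simp

lemma padic_CauchyD:
  assumes "padic_Cauchy p X" "e > 0"
  shows "\<exists>N. \<forall>m n. m \<ge> N \<longrightarrow> n \<ge> N \<longrightarrow> rat_abs p (X m - X n) < e"
  using assms unfolding padic_Cauchy_def by blast

lemma padic_Cauchy_const [simp]: "padic_Cauchy p (\<lambda>_. x)"
  by (auto simp: padic_Cauchy_def)

lemma padic_Cauchy_abs_convergent: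
  assumes "padic_Cauchy p X"
  shows "convergent (\<lambda>n. rat_abs p (X n))"
proof (rule Cauchy_convergent, rule CauchyI)
  fix e :: real assume "e > 0"
  then obtain N where N: "\<And>m n. m \<ge> N \<Longrightarrow> n \<ge> N \<Longrightarrow> rat_abs p (X m - X n) < e"
    using padic_CauchyD[OF assms] by blast
  show "\<exists>M. \<forall>m\<ge>M. \<forall>n\<ge>M. norm (rat_abs p (X m) - rat_abs p (X n)) < e"
    using N rat_abs_diff_abs by (metis order_le_less_trans real_norm_def)
qed

lemma padic_Cauchy_bounded:
  assumes "padic_Cauchy p X"
  shows "\<exists>K>0. \<forall>n. rat_abs p (X n) \<le> K"
  using convergent_imp_Bseq[OF padic_Cauchy_abs_convergent[OF assms]]
  by (auto simp: Bseq_def)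

lemma padic_Cauchy_add:
  assumes "padic_Cauchy p X" "padic_Cauchy p Y"
  shows "padic_Cauchy p (\<lambda>n. X n + Y n)"
  unfolding padic_Cauchy_def
proof (intro allI impI)
  fix e :: real assume e: "e > 0"
  obtain N where N: "\<And>m n. m \<ge> N \<Longrightarrow> n \<ge> N \<Longrightarrow> rat_abs p (X m - X n) < e"
    using padic_CauchyD[OF assms(1) e] by blast
  obtain M where M: "\<And>m n. m \<ge> M \<Longrightarrow> n \<ge> M \<Longrightarrow> rat_abs p (Y m - Y n) < e"
    using padic_CauchyD[OF assms(2) e] by blast
  have "rat_abs p (X m + Y m - (X n + Y n)) < e" if "m \<ge> max N M" "n \<ge> max N M" for m n
    using rat_abs_ultra[of "X m - X n" "Y m - Y n"] N[of m n] M[of m n] that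
    by (simp add: add_diff_add)
  thus "\<exists>N. \<forall>m\<ge>N. \<forall>n\<ge>N. rat_abs p (X m + Y m - (X n + Y n)) < e" by blast
qed

lemma padic_Cauchy_minus:
  assumes "padic_Cauchy p X"
  shows "padic_Cauchy p (\<lambda>n. - X n)"
proof -
  have "rat_abs p (- X m - - X n) = rat_abs p (X m - X n)" for m n
    using rat_abs_minus_commute by simp
  thus ?thesis using assms by (simp add: padic_Cauchy_def)
qed

lemma padic_Cauchy_mult:
  assumes X: "padic_Cauchy p X" and Y: "padic_Cauchy p Y"
  shows "padic_Cauchy p (\<lambda>n. X n * Y n)"
  unfolding padic_Cauchy_def
proof (intro allI impI)
  fix e :: real assume e: "e > 0"
  obtain K where K: "K > 0" "\<And>n. rat_abs p (X n) \<le> K" using padic_Cauchy_bounded[OF X] by blast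
  obtain L where L: "L > 0" "\<And>n. rat_abs p (Y n) \<le> L" using padic_Cauchy_bounded[OF Y] by blast
  obtain N where N: "\<And>m n. m \<ge> N \<Longrightarrow> n \<ge> N \<Longrightarrow> rat_abs p (X m - X n) < e / L"
    using padic_CauchyD[OF X divide_pos_pos[OF e L(1)]] by blast
  obtain M where M: "\<And>m n. m \<ge> M \<Longrightarrow> n \<ge> M \<Longrightarrow> rat_abs p (Y m - Y n) < e / K"
    using padic_CauchyD[OF Y divide_pos_pos[OF e K(1)]] by blast
  have "rat_abs p (X m * Y m - X n * Y n) < e" if "m \<ge> max N M" "n \<ge> max N M" for m n
  proof -
    have "rat_abs p (X m - X n) * rat_abs p (Y m) \<le> rat_abs p (X m - X n) * L"
      using L by (intro mult_left_mono) auto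
    also have "\<dots> < e" using N[of m n] that L by (simp add: pos_less_divide_eq)
    finally have 1: "rat_abs p ((X m - X n) * Y m) < e" by (simp add: rat_abs_mult)
    have "rat_abs p (X n) * rat_abs p (Y m - Y n) \<le> K * rat_abs p (Y m - Y n)"
      using K by (intro mult_right_mono) auto
    also have "\<dots> < e" using M[of m n] that K by (simp add: pos_less_divide_eq mult.commute)
    finally have 2: "rat_abs p (X n * (Y m - Y n)) < e" by (simp add: rat_abs_mult)
    have "X m * Y m - X n * Y n = (X m - X n) * Y m + X n * (Y m - Y n)"
      by (simp add: algebra_simps)
    thus ?thesis using rat_abs_ultra[of "(X m - X n) * Y m" "X n * (Y m - Y n)"] 1 2 by simp
  qed
  thus "\<exists>N. \<forall>m\<ge>N. \<forall>n\<ge>N. rat_abs p (X m * Y m - X n * Y n) < e" by blast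
qed

lemma padic_Cauchy_nonvanishing:
  assumes X: "padic_Cauchy p X" and nz: "\<not> (\<lambda>n. rat_abs p (X n)) \<longlonglongrightarrow> 0"
  shows "\<exists>c N. c > 0 \<and> (\<forall>n\<ge>N. rat_abs p (X n) > c)"
proof -
  obtain L where L: "(\<lambda>n. rat_abs p (X n)) \<longlonglongrightarrow> L"
    using padic_Cauchy_abs_convergent[OF X] unfolding convergent_def by blast
  have "L \<ge> 0" using L by (rule LIMSEQ_le_const) auto
  moreover have "L \<noteq> 0" using L nz by auto
  ultimately have L0: "L > 0" by simp
  hence "eventually (\<lambda>n. rat_abs p (X n) > L / 2) sequentially"
    using order_tendstoD(1)[OF L, of "L/2"] by simp
  then obtain N where "\<forall>n\<ge>N. rat_abs p (X n) > L / 2"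
    unfolding eventually_sequentially by blast
  thus ?thesis using L0 half_gt_zero by blast
qed

lemma padic_Cauchy_inverse:
  assumes X: "padic_Cauchy p X" and nz: "\<not> (\<lambda>n. rat_abs p (X n)) \<longlonglongrightarrow> 0"
  shows "padic_Cauchy p (\<lambda>n. inverse (X n))"
  unfolding padic_Cauchy_def
proof (intro allI impI)
  fix e :: real assume e: "e > 0"
  obtain c M where c: "c > 0" and M: "\<And>n. n \<ge> M \<Longrightarrow> rat_abs p (X n) > c"
    using padic_Cauchy_nonvanishing[OF X nz] by blast
  obtain N where N: "\<And>m n. m \<ge> N \<Longrightarrow> n \<ge> N \<Longrightarrow> rat_abs p (X m - X n) < e * (c * c)"
    using padic_CauchyD[OF X mult_pos_pos[OF e mult_pos_pos[OF c c]]] by blast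
  have "rat_abs p (inverse (X m) - inverse (X n)) < e" if mn: "m \<ge> max N M" "n \<ge> max N M" for m n
  proof -
    have cm: "rat_abs p (X m) > c" and cn: "rat_abs p (X n) > c" using M mn by auto
    have nz': "X m \<noteq> 0" "X n \<noteq> 0" using cm cn c by auto
    have "inverse (X m) - inverse (X n) = (X n - X m) * inverse (X m * X n)"
      using nz' by (simp add: field_simps)
    hence "rat_abs p (inverse (X m) - inverse (X n))
        = rat_abs p (X n - X m) / (rat_abs p (X m) * rat_abs p (X n))"
      by (simp only: rat_abs_mult rat_abs_inverse divide_inverse)
    also have "\<dots> < e"
    proof -
      have "rat_abs p (X n - X m) < e * (c * c)" using N[of n m] mn by simp
      also have "\<dots> \<le> e * (rat_abs p (X m) * rat_abs p (X n))"
        using cm cn c e by (intro mult_left_mono mult_mono) auto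
      finally show ?thesis using cm cn c by (simp add: divide_less_eq)
    qed
    finally show ?thesis .
  qed
  thus "\<exists>N. \<forall>m\<ge>N. \<forall>n\<ge>N. rat_abs p (inverse (X m) - inverse (X n)) < e" by blast
qed

lemma rat_abs_tendsto_0_le:
  assumes "f \<longlonglongrightarrow> 0" "\<And>n. rat_abs p (X n) \<le> f n"
  shows "(\<lambda>n. rat_abs p (X n)) \<longlonglongrightarrow> 0"
  using assms by (intro tendsto_sandwich[OF _ _ tendsto_const assms(1)]) auto

lemma padic_rel_refl: "padic_Cauchy p X \<Longrightarrow> padic_rel p X X"
  by (simp add: padic_rel_def)

lemma padic_rel_sym: "padic_rel p X Y \<Longrightarrow> padic_rel p Y X"
  by (simp add: padic_rel_def rat_abs_minus_commute)

lemma padic_rel_trans: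
  assumes "padic_rel p X Y" "padic_rel p Y Z"
  shows "padic_rel p X Z"
proof -
  have "(\<lambda>n. rat_abs p (X n - Y n) + rat_abs p (Y n - Z n)) \<longlonglongrightarrow> 0 + 0"
    using assms unfolding padic_rel_def by (intro tendsto_add) auto
  hence "(\<lambda>n. rat_abs p (X n - Z n)) \<longlonglongrightarrow> 0"
    using rat_abs_triangle[of "X n - Y n" "Y n - Z n" for n]
    by (intro rat_abs_tendsto_0_le[where f = "\<lambda>n. rat_abs p (X n - Y n) + rat_abs p (Y n - Z n)"]) auto
  thus ?thesis using assms by (simp add: padic_rel_def)
qed

lemma padic_rel_part_equivp: "part_equivp (padic_rel p)"
proof (rule part_equivpI)
  show "\<exists>X. padic_rel p X X" using padic_rel_refl[OF padic_Cauchy_const] by blast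
  show "symp (padic_rel p)" by (rule sympI) (rule padic_rel_sym)
  show "transp (padic_rel p)" by (rule transpI) (rule padic_rel_trans)
qed

lemma padic_rel_add:
  assumes "padic_rel p X X'" "padic_rel p Y Y'"
  shows "padic_rel p (\<lambda>n. X n + Y n) (\<lambda>n. X' n + Y' n)"
proof -
  have "(\<lambda>n. rat_abs p (X n - X' n) + rat_abs p (Y n - Y' n)) \<longlonglongrightarrow> 0 + 0"
    using assms unfolding padic_rel_def by (intro tendsto_add) auto
  hence "(\<lambda>n. rat_abs p (X n + Y n - (X' n + Y' n))) \<longlonglongrightarrow> 0"
    using rat_abs_triangle[of "X n - X' n" "Y n - Y' n" for n]
    by (intro rat_abs_tendsto_0_le[where f = "\<lambda>n. rat_abs p (X n - X' n) + rat_abs p (Y n - Y' n)"])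
       (auto simp: add_diff_add)
  thus ?thesis using assms by (simp add: padic_rel_def padic_Cauchy_add)
qed

lemma padic_rel_minus:
  assumes "padic_rel p X X'"
  shows "padic_rel p (\<lambda>n. - X n) (\<lambda>n. - X' n)"
proof -
  have "rat_abs p (- X n - - X' n) = rat_abs p (X n - X' n)" for n
    using rat_abs_minus_commute by simp
  thus ?thesis using assms by (simp add: padic_rel_def padic_Cauchy_minus)
qed

lemma padic_rel_mult:
  assumes "padic_rel p X X'" "padic_rel p Y Y'"
  shows "padic_rel p (\<lambda>n. X n * Y n) (\<lambda>n. X' n * Y' n)"
proof -
  obtain K where K: "K > 0" "\<And>n. rat_abs p (X' n) \<le> K"
    using padic_Cauchy_bounded[of X'] assms(1) unfolding padic_rel_def by blast
  obtain L where L: "L > 0" "\<And>n. rat_abs p (Y n) \<le> L"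
    using padic_Cauchy_bounded[of Y] assms(2) unfolding padic_rel_def by blast
  define f where "f = (\<lambda>n. rat_abs p (X n - X' n) * L + K * rat_abs p (Y n - Y' n))"
  have "f \<longlonglongrightarrow> 0 * L + K * 0"
    unfolding f_def using assms unfolding padic_rel_def
    by (intro tendsto_add tendsto_mult tendsto_const) auto
  hence f: "f \<longlonglongrightarrow> 0" by simp
  have "rat_abs p (X n * Y n - X' n * Y' n) \<le> f n" for n
  proof -
    have "X n * Y n - X' n * Y' n = (X n - X' n) * Y n + X' n * (Y n - Y' n)"
      by (simp add: algebra_simps)
    hence "rat_abs p (X n * Y n - X' n * Y' n)
        \<le> rat_abs p (X n - X' n) * rat_abs p (Y n) + rat_abs p (X' n) * rat_abs p (Y n - Y' n)"
      using rat_abs_triangle[of "(X n - X' n) * Y n" "X' n * (Y n - Y' n)"]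
      by (simp add: rat_abs_mult)
    also have "\<dots> \<le> f n"
      unfolding f_def using K L by (intro add_mono mult_left_mono mult_right_mono) auto
    finally show ?thesis .
  qed
  hence "(\<lambda>n. rat_abs p (X n * Y n - X' n * Y' n)) \<longlonglongrightarrow> 0"
    by (rule rat_abs_tendsto_0_le[OF f])
  thus ?thesis using assms by (simp add: padic_rel_def padic_Cauchy_mult)
qed

lemma padic_rel_abs_diff:
  assumes "padic_rel p X Y"
  shows "(\<lambda>n. rat_abs p (X n) - rat_abs p (Y n)) \<longlonglongrightarrow> 0"
proof (rule Lim_null_comparison)
  show "\<forall>\<^sub>F n in sequentially. norm (rat_abs p (X n) - rat_abs p (Y n)) \<le> rat_abs p (X n - Y n)"
    by (simp add: rat_abs_diff_abs)
  show "(\<lambda>n. rat_abs p (X n - Y n)) \<longlonglongrightarrow> 0"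
    using assms by (simp add: padic_rel_def)
qed

lemma padic_rel_abs_tendsto:
  assumes "padic_rel p X Y" "(\<lambda>n. rat_abs p (X n)) \<longlonglongrightarrow> L"
  shows "(\<lambda>n. rat_abs p (Y n)) \<longlonglongrightarrow> L"
  using tendsto_diff[OF assms(2) padic_rel_abs_diff[OF assms(1)]] by simp

lemma padic_rel_abs_tendsto_iff:
  assumes "padic_rel p X Y"
  shows "(\<lambda>n. rat_abs p (X n)) \<longlonglongrightarrow> L \<longleftrightarrow> (\<lambda>n. rat_abs p (Y n)) \<longlonglongrightarrow> L"
  using padic_rel_abs_tendsto[OF assms] padic_rel_abs_tendsto[OF padic_rel_sym[OF assms]] by blast

lemma padic_rel_inverse:
  assumes XY: "padic_rel p X Y" and nz: "\<not> (\<lambda>n. rat_abs p (X n)) \<longlonglongrightarrow> 0"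
  shows "padic_rel p (\<lambda>n. inverse (X n)) (\<lambda>n. inverse (Y n))"
proof -
  have X: "padic_Cauchy p X" and Y: "padic_Cauchy p Y"
    and lim: "(\<lambda>n. rat_abs p (X n - Y n)) \<longlonglongrightarrow> 0"
    using XY by (auto simp: padic_rel_def)
  have nzY: "\<not> (\<lambda>n. rat_abs p (Y n)) \<longlonglongrightarrow> 0"
    using nz padic_rel_abs_tendsto_iff[OF XY] by blast
  have IX: "padic_Cauchy p (\<lambda>n. inverse (X n))" using padic_Cauchy_inverse[OF X nz] .
  have IY: "padic_Cauchy p (\<lambda>n. inverse (Y n))" using padic_Cauchy_inverse[OF Y nzY] .
  obtain c N where c: "c > 0" "\<And>n. n \<ge> N \<Longrightarrow> rat_abs p (X n) > c"
    using padic_Cauchy_nonvanishing[OF X nz] by blast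
  obtain d M where d: "d > 0" "\<And>n. n \<ge> M \<Longrightarrow> rat_abs p (Y n) > d"
    using padic_Cauchy_nonvanishing[OF Y nzY] by blast
  obtain K where K: "K > 0" "\<And>n. rat_abs p (inverse (X n)) \<le> K"
    using padic_Cauchy_bounded[OF IX] by blast
  obtain L where L: "L > 0" "\<And>n. rat_abs p (inverse (Y n)) \<le> L"
    using padic_Cauchy_bounded[OF IY] by blast
  have le: "rat_abs p (inverse (X n) - inverse (Y n)) \<le> rat_abs p (X n - Y n) * (K * L)"
    if n: "n \<ge> max N M" for n
  proof -
    have "X n \<noteq> 0" "Y n \<noteq> 0" using c(2)[of n] d(2)[of n] c(1) d(1) n by auto
    hence "inverse (X n) - inverse (Y n) = (Y n - X n) * (inverse (X n) * inverse (Y n))"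
      by (simp add: field_simps)
    hence "rat_abs p (inverse (X n) - inverse (Y n))
        = rat_abs p (X n - Y n) * (rat_abs p (inverse (X n)) * rat_abs p (inverse (Y n)))"
      by (simp only: rat_abs_mult rat_abs_minus_commute[of "X n" "Y n"])
    also have "\<dots> \<le> rat_abs p (X n - Y n) * (K * L)"
      using K L less_imp_le[OF K(1)] by (intro mult_left_mono mult_mono) auto
    finally show ?thesis .
  qed
  have "(\<lambda>n. rat_abs p (X n - Y n) * (K * L)) \<longlonglongrightarrow> 0"
    using tendsto_mult_right[OF lim, of "K * L"] by simp
  hence "(\<lambda>n. rat_abs p (inverse (X n) - inverse (Y n))) \<longlonglongrightarrow> 0"
    by (rule Lim_null_comparison[rotated])
       (use le in \<open>auto simp: eventually_sequentially intro!: exI[of _ "max N M"]\<close>)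
  thus ?thesis using IX IY by (simp add: padic_rel_def)
qed

end


section \<open>The field of p-adic numbers\<close>

text \<open>
  The prime is the cardinality of the type argument, so that a statement about
  \<open>'p padic\<close> with \<open>'p\<close> of class \<open>prime_card\<close> is a statement about all primes.
\<close>

typedef (overloaded) 'p padic =
  "{C. \<exists>X. padic_rel CARD('p::prime_card) X X \<and> C = Collect (padic_rel CARD('p) X)}"
  morphisms padic_class padic_of_class
  using padic_rel_refl[OF prime_card padic_Cauchy_const[OF prime_card]] by blast

definition abs_padic :: "(nat \<Rightarrow> rat) \<Rightarrow> 'p::prime_card padic" where
  "abs_padic X = padic_of_class (Collect (padic_rel CARD('p) X))"

definition rep_padic :: "'p::prime_card padic \<Rightarrow> nat \<Rightarrow> rat" where
  "rep_padic x = (SOME X. X \<in> padic_class x)"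

definition cr_padic :: "(nat \<Rightarrow> rat) \<Rightarrow> 'p::prime_card padic \<Rightarrow> bool" where
  "cr_padic = (\<lambda>X x. padic_rel CARD('p) X X \<and> abs_padic X = x)"

lemma Quotient_padic:
  "Quotient (padic_rel CARD('p::prime_card)) abs_padic rep_padic (cr_padic :: _ \<Rightarrow> 'p padic \<Rightarrow> bool)"
proof (rule Quotient3_to_Quotient)
  have qt: "quot_type (padic_rel CARD('p)) (padic_of_class :: _ \<Rightarrow> 'p padic) padic_class"
  proof
    show "part_equivp (padic_rel CARD('p))" by (rule padic_rel_part_equivp[OF prime_card])
    show "\<exists>X. padic_rel CARD('p) X X \<and> padic_class y = Collect (padic_rel CARD('p) X)"
      for y :: "'p padic" using padic_class[of y] by simp
  qed (simp_all add: padic_class_inverse padic_of_class_inverse padic_class_inject)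
  have "abs_padic = quot_type.abs (padic_rel CARD('p)) (padic_of_class :: _ \<Rightarrow> 'p padic)"
    by (rule ext) (simp only: abs_padic_def quot_type.abs_def[OF qt])
  moreover have "rep_padic = quot_type.rep (padic_class :: 'p padic \<Rightarrow> _)"
    by (rule ext) (simp only: rep_padic_def quot_type.rep_def[OF qt])
  ultimately show "Quotient3 (padic_rel CARD('p)) (abs_padic :: _ \<Rightarrow> 'p padic) rep_padic"
    using quot_type.Quotient[OF qt] by simp
  show "(cr_padic :: _ \<Rightarrow> 'p padic \<Rightarrow> bool) \<equiv> \<lambda>X x. padic_rel CARD('p) X X \<and> abs_padic X = x"
    by (rule eq_reflection) (rule cr_padic_def)
qed

setup_lifting Quotient_padic

instantiation padic :: (prime_card) field
begin

lift_definition zero_padic :: "'a padic" is "\<lambda>_. 0"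
  by (simp add: padic_rel_refl prime_card)

lift_definition one_padic :: "'a padic" is "\<lambda>_. 1"
  by (simp add: padic_rel_refl prime_card)

lift_definition plus_padic :: "'a padic \<Rightarrow> 'a padic \<Rightarrow> 'a padic" is "\<lambda>X Y n. X n + Y n"
  by (rule padic_rel_add[OF prime_card])

lift_definition uminus_padic :: "'a padic \<Rightarrow> 'a padic" is "\<lambda>X n. - X n"
  by (rule padic_rel_minus[OF prime_card])

lift_definition times_padic :: "'a padic \<Rightarrow> 'a padic \<Rightarrow> 'a padic" is "\<lambda>X Y n. X n * Y n"
  by (rule padic_rel_mult[OF prime_card])

lift_definition inverse_padic :: "'a padic \<Rightarrow> 'a padic" is
  "\<lambda>X. if (\<lambda>n. rat_abs CARD('a) (X n)) \<longlonglongrightarrow> 0 then (\<lambda>_. 0) else (\<lambda>n. inverse (X n))"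
  using padic_rel_abs_tendsto_iff[OF prime_card[where 'a = 'a]]
    padic_rel_inverse[OF prime_card[where 'a = 'a]]
  by (simp add: padic_rel_refl prime_card)

definition minus_padic :: "'a padic \<Rightarrow> 'a padic \<Rightarrow> 'a padic" where
  "minus_padic x y = x + - y"

definition divide_padic :: "'a padic \<Rightarrow> 'a padic \<Rightarrow> 'a padic" where
  "divide_padic x y = x * inverse y"

instance
proof
  have eqI: "padic_rel CARD('a) X Y" if "padic_Cauchy CARD('a) X" "\<And>n. X n = Y n" for X Y
  proof -
    have "X = Y" using that(2) by (rule ext)
    thus ?thesis using that(1) padic_rel_refl[OF prime_card] by blast
  qed
  have C: "padic_Cauchy CARD('a) X" if "padic_rel CARD('a) X X" for X
    using that by (simp add: padic_rel_def)
  note CI = padic_Cauchy_add[OF prime_card[where 'a = 'a]] padic_Cauchy_mult[OF prime_card[where 'a = 'a]]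
    padic_Cauchy_minus[OF prime_card[where 'a = 'a]] padic_Cauchy_const[OF prime_card[where 'a = 'a]]
  fix a b c :: "'a padic"
  show "a * b * c = a * (b * c)"
    by transfer (rule eqI; simp add: CI C mult.assoc)
  show "a * b = b * a"
    by transfer (rule eqI; simp add: CI C mult.commute)
  show "1 * a = a"
    by transfer (rule eqI; simp add: CI C)
  show "a + b + c = a + (b + c)"
    by transfer (rule eqI; simp add: CI C add.assoc)
  show "a + b = b + a"
    by transfer (rule eqI; simp add: CI C add.commute)
  show "0 + a = a"
    by transfer (rule eqI; simp add: CI C)
  show "- a + a = 0"
    by transfer (rule eqI; simp add: CI C)
  show "a - b = a + - b" by (simp add: minus_padic_def)
  show "(a + b) * c = a * c + b * c"
    by transfer (rule eqI; simp add: CI C algebra_simps)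
  show "(0 :: 'a padic) \<noteq> 1"
    by transfer (auto simp: padic_rel_def prime_card rat_abs_minus[OF prime_card] LIMSEQ_const_iff)
  show "a div b = a * inverse b" by (simp add: divide_padic_def)
  show "inverse (0 :: 'a padic) = 0"
    by transfer (simp add: prime_card padic_rel_refl)
  show "inverse a * a = 1" if "a \<noteq> 0"
    using that
  proof transfer
    fix X assume "padic_rel CARD('a) X X" and nr: "\<not> padic_rel CARD('a) X (\<lambda>_. 0)"
    hence X: "padic_Cauchy CARD('a) X" by (simp add: padic_rel_def)
    have nz: "\<not> (\<lambda>n. rat_abs CARD('a) (X n)) \<longlonglongrightarrow> 0"
      using nr X by (simp add: padic_rel_def prime_card)
    obtain c N where c: "c > 0" "\<And>n. n \<ge> N \<Longrightarrow> rat_abs CARD('a) (X n) > c"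
      using padic_Cauchy_nonvanishing[OF prime_card X nz] by blast
    have "eventually (\<lambda>n. rat_abs CARD('a) (inverse (X n) * X n - 1) = 0) sequentially"
      unfolding eventually_sequentially
    proof (intro exI allI impI)
      fix n assume "n \<ge> N"
      hence "X n \<noteq> 0" using c(1) c(2)[of n] by (auto simp: prime_card)
      thus "rat_abs CARD('a) (inverse (X n) * X n - 1) = 0" by (simp add: prime_card)
    qed
    hence "(\<lambda>n. rat_abs CARD('a) (inverse (X n) * X n - 1)) \<longlonglongrightarrow> 0"
      by (rule tendsto_eventually)
    thus "padic_rel CARD('a) (\<lambda>n. (if (\<lambda>n. rat_abs CARD('a) (X n)) \<longlonglongrightarrow> 0
        then \<lambda>_. 0 else (\<lambda>n. inverse (X n))) n * X n) (\<lambda>_. 1)"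
      using nz X padic_Cauchy_inverse[OF prime_card X nz]
      by (simp add: padic_rel_def CI)
  qed
qed

end

lemma of_nat_padic: "(of_nat k :: 'p::prime_card padic) = abs_padic (\<lambda>_. of_nat k)"
proof (induction k)
  case 0
  show ?case by (simp add: zero_padic.abs_eq)
next
  case (Suc k)
  show ?case
    unfolding of_nat_Suc Suc one_padic.abs_eq
    by (subst plus_padic.abs_eq) (auto simp: padic_rel_refl prime_card)
qed

instance padic :: (prime_card) field_char_0
proof
  show "inj (of_nat :: nat \<Rightarrow> 'a padic)"
  proof (rule injI)
    fix m n assume "(of_nat m :: 'a padic) = of_nat n"
    hence "padic_rel CARD('a) (\<lambda>_. of_nat m) (\<lambda>_. of_nat n)"
      unfolding of_nat_padic
      by (subst Quotient_rel[OF Quotient_padic, symmetric]) (auto simp: padic_rel_refl prime_card)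
    thus "m = n" by (auto simp: padic_rel_def LIMSEQ_const_iff prime_card)
  qed
qed

lift_definition padic_norm :: "'p::prime_card padic \<Rightarrow> real" is
  "\<lambda>X. lim (\<lambda>n. rat_abs CARD('p) (X n))"
  by (simp add: lim_def padic_rel_abs_tendsto_iff[OF prime_card])

lemma padic_norm_tendsto:
  assumes "padic_Cauchy CARD('p::prime_card) X"
  shows "(\<lambda>n. rat_abs CARD('p) (X n)) \<longlonglongrightarrow> lim (\<lambda>n. rat_abs CARD('p) (X n))"
  using padic_Cauchy_abs_convergent[OF prime_card assms] convergent_LIMSEQ_iff by blast

lemma padic_norm_nonneg: "padic_norm x \<ge> 0"
proof transfer
  fix X assume "padic_rel CARD('a) X X"
  hence "padic_Cauchy CARD('a) X" by (simp add: padic_rel_def)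
  from padic_norm_tendsto[OF this]
  show "0 \<le> lim (\<lambda>n. rat_abs CARD('a) (X n))"
    by (rule LIMSEQ_le_const) (auto simp: prime_card)
qed

lemma padic_norm_eq_0_iff: "padic_norm x = 0 \<longleftrightarrow> x = 0"
proof transfer
  fix X assume "padic_rel CARD('a) X X"
  hence X: "padic_Cauchy CARD('a) X" by (simp add: padic_rel_def)
  show "lim (\<lambda>n. rat_abs CARD('a) (X n)) = 0 \<longleftrightarrow> padic_rel CARD('a) X (\<lambda>_. 0)"
    using padic_norm_tendsto[OF X] X limI[of "\<lambda>n. rat_abs CARD('a) (X n)" 0]
    by (auto simp: padic_rel_def prime_card)
qed

lemma padic_norm_ultra: "padic_norm (x + y) \<le> max (padic_norm x) (padic_norm y)"
proof transfer
  fix X Y assume "padic_rel CARD('a) X X" "padic_rel CARD('a) Y Y"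
  hence X: "padic_Cauchy CARD('a) X" and Y: "padic_Cauchy CARD('a) Y"
    by (auto simp: padic_rel_def)
  show "lim (\<lambda>n. rat_abs CARD('a) (X n + Y n))
      \<le> max (lim (\<lambda>n. rat_abs CARD('a) (X n))) (lim (\<lambda>n. rat_abs CARD('a) (Y n)))"
    by (rule LIMSEQ_le[OF padic_norm_tendsto[OF padic_Cauchy_add[OF prime_card X Y]]
          tendsto_max[OF padic_norm_tendsto[OF X] padic_norm_tendsto[OF Y]]])
       (auto simp: rat_abs_ultra[OF prime_card])
qed

lemma padic_norm_minus: "padic_norm (- x) = padic_norm x"
  by transfer (simp add: rat_abs_minus[OF prime_card])

lemma padic_norm_mult: "padic_norm (x * y) = padic_norm x * padic_norm y"
proof transfer
  fix X Y assume "padic_rel CARD('a) X X" "padic_rel CARD('a) Y Y"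
  hence X: "padic_Cauchy CARD('a) X" and Y: "padic_Cauchy CARD('a) Y"
    by (auto simp: padic_rel_def)
  show "lim (\<lambda>n. rat_abs CARD('a) (X n * Y n))
      = lim (\<lambda>n. rat_abs CARD('a) (X n)) * lim (\<lambda>n. rat_abs CARD('a) (Y n))"
    using tendsto_mult[OF padic_norm_tendsto[OF X] padic_norm_tendsto[OF Y]]
    by (intro limI) (simp add: rat_abs_mult[OF prime_card])
qed

instantiation padic :: (prime_card) metric_space
begin

definition dist_padic :: "'a padic \<Rightarrow> 'a padic \<Rightarrow> real" where
  "dist_padic x y = padic_norm (x - y)"

definition uniformity_padic :: "('a padic \<times> 'a padic) filter" where
  "uniformity_padic = (INF e\<in>{0<..}. principal {(x, y). dist x y < e})"

definition open_padic :: "'a padic set \<Rightarrow> bool" where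
  "open_padic U \<longleftrightarrow> (\<forall>x\<in>U. eventually (\<lambda>(x', y). x' = x \<longrightarrow> y \<in> U) uniformity)"

instance
proof
  fix x y z :: "'a padic"
  show "dist x y = 0 \<longleftrightarrow> x = y"
    by (simp add: dist_padic_def padic_norm_eq_0_iff)
  have "x - y = (x - z) + - (y - z)" by simp
  hence "padic_norm (x - y) \<le> max (padic_norm (x - z)) (padic_norm (y - z))"
    using padic_norm_ultra[of "x - z" "- (y - z)"] by (simp only: padic_norm_minus)
  thus "dist x y \<le> dist x z + dist y z"
    using padic_norm_nonneg[of "x - z"] padic_norm_nonneg[of "y - z"]
    by (simp add: dist_padic_def)
qed (simp_all add: uniformity_padic_def open_padic_def)

end

definition padic_val :: "'p::prime_card padic \<Rightarrow> ereal" where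
  "padic_val x = (if x = 0 then \<infinity> else ereal (- log (real CARD('p)) (padic_norm x)))"


section \<open>Balanced digit expansions\<close>

definition balanced_expansion :: "'p::prime_card padic \<Rightarrow> int \<Rightarrow> (int \<Rightarrow> int) \<Rightarrow> bool" where
  "balanced_expansion x r a \<longleftrightarrow>
     (\<forall>n\<ge>-r. a n \<in> {- ((int CARD('p) - 1) div 2) .. (int CARD('p) - 1) div 2}) \<and>
     (\<lambda>N. \<Sum>n\<in>{-r..int N}. of_int (a n) * of_nat CARD('p) powi n) \<longlonglongrightarrow> x"

text \<open>
  For odd \<open>CARD('p)\<close> every \<open>x\<close> has a balanced expansion, unique up to leading
  zeros, so the descriptions below are proper.
\<close>

definition browkin_s :: "'p::prime_card padic \<Rightarrow> rat" where
  "browkin_s x = (THE q. \<exists>r a. balanced_expansion x r a \<and>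
     q = (\<Sum>n\<in>{-r..0}. of_int (a n) * of_nat CARD('p) powi n))"

definition browkin_t :: "'p::prime_card padic \<Rightarrow> rat" where
  "browkin_t x = (THE q. \<exists>r a. balanced_expansion x r a \<and>
     q = (\<Sum>n\<in>{-r..-1}. of_int (a n) * of_nat CARD('p) powi n))"


section \<open>Browkin's second algorithm\<close>

definition browkin2_quotient :: "nat \<Rightarrow> 'p::prime_card padic \<Rightarrow> rat" where
  "browkin2_quotient n x =
     (if even n then browkin_s x
      else if padic_val (x - of_rat (browkin_t x)) = 0 then browkin_t x
      else browkin_t x - sgn (browkin_t x))"

text \<open>Complete quotients; \<open>None\<close> once the algorithm has stopped.\<close>

primrec browkin2_complete :: "'p::prime_card padic \<Rightarrow> nat \<Rightarrow> 'p padic option" where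
  "browkin2_complete x 0 = Some x"
| "browkin2_complete x (Suc n) =
     (case browkin2_complete x n of
        None \<Rightarrow> None
      | Some y \<Rightarrow>
          (let b = of_rat (browkin2_quotient n y)
           in if y = b then None else Some (1 / (y - b))))"

definition browkin2 :: "'p::prime_card padic \<Rightarrow> nat \<Rightarrow> rat option" where
  "browkin2 x n = map_option (browkin2_quotient n) (browkin2_complete x n)"


section \<open>Continued fractions\<close>

text \<open>Meaningful as long as no proper tail evaluates to \<open>0\<close>.\<close>

fun cfrac_eval :: "'a::field list \<Rightarrow> 'a" where
  "cfrac_eval [] = 0"
| "cfrac_eval [b] = b"
| "cfrac_eval (b # c # bs) = b + 1 / cfrac_eval (c # bs)"

definition cfrac_value :: "(nat \<Rightarrow> rat) \<Rightarrow> 'p::prime_card padic \<Rightarrow> bool" where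
  "cfrac_value b x \<longleftrightarrow> (\<lambda>n. of_rat (cfrac_eval (map b [0..<Suc n]))) \<longlonglongrightarrow> x"

definition eventually_periodic :: "'a list \<Rightarrow> 'a list \<Rightarrow> nat \<Rightarrow> 'a" where
  "eventually_periodic us vs n =
     (if n < length us then us ! n else vs ! ((n - length us) mod length vs))"

end

theory Submission
  imports Defs "HOL-Number_Theory.Cong"
begin

text \<open>
  Let \<open>X\<close> be the square root of \<open>1 - p\<^sup>m\<close> congruent to \<open>1\<close> modulo \<open>p\<close>, so that \<open>\<surd>D = p X / (1 - p)\<close>.
  It exists by Newton's method with the derivative replaced by \<open>2\<close> (\<open>one_unit_has_sqrt\<close>), and the other root
  \<open>- X\<close> is not congruent to \<open>1\<close>, which gives uniqueness. Since \<open>1 + X\<close> is a unit, the factorization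
  \<open>(1 - X) (1 + X) = p\<^sup>m\<close> shows that \<open>1 - X\<close> has valuation \<open>m\<close>.

  The complete quotients of the expansion are explicit fractions in \<open>p\<close> and \<open>X\<close>
  (\<open>sqrt_complete\<close>); that they satisfy \<open>\<alpha>\<^sub>n = b\<^sub>n + 1 / \<alpha>\<^sub>n\<^sub>+\<^sub>1\<close> is a rational identity modulo the
  equation of \<open>X\<close> (\<open>sqrt_complete_rec\<close>), and their norms are \<open>1\<close> at positive even indices and at
  least \<open>p\<close> at odd ones (\<open>norm_sqrt_complete\<close>). Everything else follows from these two facts.

  Convergence: the products of consecutive norms are at least \<open>p\<close>, and under this condition the
  error of a convergent shrinks by the factor \<open>p\<close> with each further partial quotient
  (\<open>cfrac_eval_error\<close>). This works for every odd \<open>p\<close>.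

  The algorithm: it has to be seen that \<open>b\<^sub>n\<close> is the prescribed truncation of \<open>\<alpha>\<^sub>n\<close>. A truncation of
  a balanced expansion is the only element \<open>q\<close> of \<open>\<int>[1/p]\<close> that is \<open>p\<close>-adically close to the number
  and small in the real absolute value, because a nonzero element of \<open>\<int>[1/p]\<close> cannot be small at both
  places (\<open>product_formula_ge_1\<close>, \<open>balanced_truncation_unique\<close>). The first condition is the norm of
  \<open>\<alpha>\<^sub>n - b\<^sub>n = 1 / \<alpha>\<^sub>n\<^sub>+\<^sub>1\<close>; the second is an elementary estimate that holds for \<open>p \<ge> 5\<close>
  (\<open>sqrt_quotient_small\<close>). Both are insensitive to the sign, so \<open>\<surd>D\<close> and \<open>- \<surd>D\<close> are treated together.
\<close>

section \<open>The p-adic norm\<close>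

lemma rat_abs_of_int:
  assumes "prime p" "a \<noteq> 0"
  shows "rat_abs p (of_int a) = 1 / real p ^ multiplicity (int p) a"
  using rat_val_Fract[OF assms(1), of a 1] assms(2)
  by (simp add: rat_abs_def power_int_minus field_simps)

lemma rat_abs_of_int_le_1:
  assumes "prime p"
  shows "rat_abs p (of_int a) \<le> 1"
proof (cases "a = 0")
  case True
  then show ?thesis using assms by (simp add: rat_abs_0)
next
  case False
  have "1 \<le> real p ^ multiplicity (int p) a"
    using p_gt_1[OF assms] by (intro one_le_power) simp
  then show ?thesis using rat_abs_of_int[OF assms False] by (simp add: divide_le_eq)
qed

lemma rat_abs_of_int_unit:
  assumes "prime p" "\<not> int p dvd a"
  shows "rat_abs p (of_int a) = 1"
proof -
  have "a \<noteq> 0" using assms(2) by auto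
  then show ?thesis
    using rat_abs_of_int[OF assms(1)] assms(2) by (simp add: not_dvd_imp_multiplicity_0)
qed

lemma odd_prime_ge_3:
  fixes p :: nat
  assumes "prime p" "odd p"
  shows "p \<ge> 3"
  using assms prime_gt_1_nat[of p] by (cases "p = 2") auto

lemma odd_prime_not_dvd_2:
  assumes "prime p" "odd p"
  shows "\<not> int p dvd 2"
  using odd_prime_ge_3[OF assms] zdvd_imp_le[of "int p" 2] by auto

lemma rat_abs_prime:
  assumes "prime p"
  shows "rat_abs p (of_nat p) = 1 / real p"
  using rat_abs_of_int[OF assms, of "int p"] prime_elem_p[OF assms] assms
  by (simp add: prime_gt_0_nat)

lemma rat_abs_power: "prime p \<Longrightarrow> rat_abs p (x ^ n) = rat_abs p x ^ n"
  by (induction n) (simp_all add: rat_abs_1 rat_abs_mult)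

lemma rat_abs_divide: "prime p \<Longrightarrow> rat_abs p (x / y) = rat_abs p x / rat_abs p y"
  by (simp add: divide_inverse rat_abs_mult rat_abs_inverse)

lemma rat_abs_of_int_dvd:
  assumes "prime p" "int p dvd a"
  shows "rat_abs p (of_int a) \<le> 1 / real p"
proof -
  obtain c where c: "a = int p * c" using assms(2) by blast
  have "rat_abs p (of_int a) = 1 / real p * rat_abs p (of_int c)"
    using rat_abs_prime[OF assms(1)] by (simp add: c rat_abs_mult[OF assms(1)])
  also have "\<dots> \<le> 1 / real p * 1"
    using rat_abs_of_int_le_1[OF assms(1), of c] by (intro mult_left_mono) auto
  finally show ?thesis by simp
qed

text \<open>
  The embedding of the rationals is given abstractly by the field structure; the following two
  lemmas identify it with constant Cauchy sequences, which makes the norm of a rational computable.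
\<close>

lemma abs_padic_of_int: "(of_int a :: 'p::prime_card padic) = abs_padic (\<lambda>_. of_int a)"
proof (cases "a \<ge> 0")
  case True
  then show ?thesis using of_nat_padic[where 'p = 'p, of "nat a"] by simp
next
  case False
  then have a: "a = - int (nat (- a))" by simp
  have "(of_int a :: 'p padic) = - of_nat (nat (- a))" by (subst a) simp
  also have "\<dots> = abs_padic (\<lambda>_. - of_nat (nat (- a)))"
    unfolding of_nat_padic by (subst uminus_padic.abs_eq) (auto simp: padic_rel_refl prime_card)
  also have "(\<lambda>_::nat. - of_nat (nat (- a))) = (\<lambda>_. of_int a :: rat)"
    using False by (intro ext) (simp add: of_nat_nat)
  finally show ?thesis .
qed

lemma of_rat_eq_abs_padic: "(of_rat q :: 'p::prime_card padic) = abs_padic (\<lambda>_. q)"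
proof -
  obtain a b where ab: "b \<noteq> 0" "q = of_int a / of_int b"
    using rat_cases[OF prime_card[where 'a = 'p]] by metis
  have "abs_padic (\<lambda>_. q) * (of_int b :: 'p padic) = abs_padic (\<lambda>_. q * of_int b)"
    unfolding abs_padic_of_int
    by (subst times_padic.abs_eq) (auto simp: padic_rel_refl prime_card)
  also have "\<dots> = of_int a" using ab by (simp add: abs_padic_of_int)
  finally have "abs_padic (\<lambda>_. q) = (of_int a / of_int b :: 'p padic)"
    using ab(1) by (simp add: field_simps)
  then show ?thesis using ab by (simp add: of_rat_divide)
qed

lemma padic_norm_abs_padic:
  assumes "padic_Cauchy CARD('p) X"
  shows "(\<lambda>n. rat_abs CARD('p) (X n)) \<longlonglongrightarrow> padic_norm (abs_padic X :: 'p::prime_card padic)"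
  using padic_norm_tendsto[OF assms] padic_rel_refl[OF prime_card assms]
  by (simp add: padic_norm.abs_eq)

lemma padic_norm_of_rat: "padic_norm (of_rat q :: 'p::prime_card padic) = rat_abs CARD('p) q"
proof -
  have "(\<lambda>n. rat_abs CARD('p) q) \<longlonglongrightarrow> padic_norm (of_rat q :: 'p padic)"
    unfolding of_rat_eq_abs_padic
    by (rule padic_norm_abs_padic) (simp add: padic_Cauchy_const prime_card)
  then show ?thesis by (simp add: LIMSEQ_const_iff)
qed

lemma abs_padic_diff_of_rat:
  assumes "padic_Cauchy CARD('p::prime_card) X"
  shows "(abs_padic X :: 'p padic) - of_rat q = abs_padic (\<lambda>n. X n - q)"
proof -
  have "- (of_rat q :: 'p padic) = abs_padic (\<lambda>_. - q)"
    by (simp add: of_rat_eq_abs_padic[symmetric] of_rat_minus)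
  then have "(abs_padic X :: 'p padic) - of_rat q = abs_padic X + abs_padic (\<lambda>_. - q)"
    by (simp add: minus_padic_def)
  also have "\<dots> = abs_padic (\<lambda>n. X n - q)"
    using assms by (subst plus_padic.abs_eq)
      (auto simp: padic_rel_refl prime_card padic_Cauchy_const)
  finally show ?thesis .
qed

lemma rat_dense_padic:
  fixes x :: "'p::prime_card padic"
  assumes "e > 0"
  obtains q where "padic_norm (x - of_rat q) < e"
proof -
  obtain X where X: "padic_Cauchy CARD('p) X" "x = abs_padic X"
    using Quotient_rep_reflp[OF Quotient_padic, of x] Quotient_abs_rep[OF Quotient_padic, of x]
    unfolding padic_rel_def by metis
  obtain N where N: "\<And>m n. m \<ge> N \<Longrightarrow> n \<ge> N \<Longrightarrow> rat_abs CARD('p) (X m - X n) < e / 2"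
    using padic_CauchyD[OF prime_card X(1), of "e / 2"] assms by auto
  have "padic_Cauchy CARD('p) (\<lambda>n. X n - X N)"
    using padic_Cauchy_add[OF prime_card X(1) padic_Cauchy_const[OF prime_card], of "- X N"]
    by simp
  then have "(\<lambda>n. rat_abs CARD('p) (X n - X N)) \<longlonglongrightarrow> padic_norm (x - of_rat (X N))"
    unfolding X(2) abs_padic_diff_of_rat[OF X(1)] by (rule padic_norm_abs_padic)
  then have "padic_norm (x - of_rat (X N)) \<le> e / 2"
    by (rule LIMSEQ_le_const2) (use N in \<open>auto intro!: exI[of _ N] less_imp_le\<close>)
  then show ?thesis using that[of "X N"] assms by simp
qed

lemma padic_norm_0 [simp]: "padic_norm 0 = 0"
  by (simp add: padic_norm_eq_0_iff)

lemma padic_norm_1 [simp]: "padic_norm (1 :: 'p::prime_card padic) = 1"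
  using padic_norm_of_rat[where 'p = 'p, of 1] by (simp add: rat_abs_1 prime_card)

lemma padic_norm_of_int: "padic_norm (of_int a :: 'p::prime_card padic) = rat_abs CARD('p) (of_int a)"
  using padic_norm_of_rat[where 'p = 'p, of "of_int a"] by simp

lemma padic_norm_2:
  assumes "odd CARD('p)"
  shows "padic_norm (2 :: 'p::prime_card padic) = 1"
  using padic_norm_of_int[where 'p = 'p, of 2]
    rat_abs_of_int_unit[OF prime_card odd_prime_not_dvd_2[OF prime_card assms]] by simp

lemma padic_norm_prime: "padic_norm (of_nat CARD('p) :: 'p::prime_card padic) = 1 / real CARD('p)"
  using padic_norm_of_rat[where 'p = 'p, of "of_nat CARD('p)"] by (simp add: rat_abs_prime prime_card)

lemma padic_norm_inverse: "padic_norm (inverse x :: 'p::prime_card padic) = inverse (padic_norm x)"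
proof (cases "x = 0")
  case False
  have "padic_norm x * padic_norm (inverse x) = 1"
    using False padic_norm_mult[of x "inverse x"] by simp
  then show ?thesis by (metis inverse_unique)
qed simp

lemma padic_norm_divide:
  "padic_norm (x / y :: 'p::prime_card padic) = padic_norm x / padic_norm y"
  by (simp add: divide_inverse padic_norm_mult padic_norm_inverse)

lemma padic_norm_power:
  "padic_norm (x ^ n :: 'p::prime_card padic) = padic_norm x ^ n"
  by (induction n) (simp_all add: padic_norm_mult)

lemma padic_norm_power_int:
  "padic_norm (x powi n :: 'p::prime_card padic) = padic_norm x powi n"
  by (simp add: power_int_def padic_norm_power padic_norm_inverse)

lemma padic_norm_diff_commute: "padic_norm (x - y) = padic_norm (y - x)"
  using padic_norm_minus[of "x - y"] by simp

lemma padic_norm_ultra_diff: "padic_norm (x - y) \<le> max (padic_norm x) (padic_norm y)"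
  using padic_norm_ultra[of x "- y"] by (simp add: padic_norm_minus)

text \<open>The isosceles triangle principle: the larger of two unequal norms is the norm of the sum.\<close>

lemma padic_norm_add_eq:
  assumes "padic_norm y < padic_norm x"
  shows "padic_norm (x + y) = padic_norm x"
  using padic_norm_ultra[of x y] padic_norm_ultra_diff[of "x + y" y] assms by simp

lemma padic_norm_diff_eq:
  assumes "padic_norm y < padic_norm x"
  shows "padic_norm (x - y) = padic_norm x"
  using padic_norm_add_eq[of "- y" x] assms by (simp add: padic_norm_minus)

lemma padic_norm_prime_less_1: "padic_norm (of_nat CARD('p) :: 'p::prime_card padic) < 1"
  using p_gt_1[OF prime_card[where 'a = 'p]] by (simp add: padic_norm_prime)

lemma padic_norm_1_minus_prime: "padic_norm (1 - of_nat CARD('p) :: 'p::prime_card padic) = 1"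
  using padic_norm_diff_eq[of "of_nat CARD('p)" "1 :: 'p padic"] padic_norm_prime_less_1[where 'p = 'p]
  by simp

lemma padic_norm_one_unit:
  assumes "padic_norm (x - 1) < 1"
  shows "padic_norm x = 1"
  using padic_norm_add_eq[of "x - 1" 1] assms by simp

lemma padic_norm_1_plus_one_unit:
  fixes x :: "'p::prime_card padic"
  assumes "odd CARD('p)" "padic_norm (x - 1) < 1"
  shows "padic_norm (1 + x) = 1"
  using padic_norm_add_eq[of "x - 1" 2] assms padic_norm_2[OF assms(1)] by (simp add: algebra_simps)

lemma padic_norm_sum_le:
  fixes f :: "'a \<Rightarrow> 'p::prime_card padic"
  assumes "\<And>i. i \<in> A \<Longrightarrow> padic_norm (f i) \<le> c" "c \<ge> 0"
  shows "padic_norm (sum f A) \<le> c"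
  using assms(1)
proof (induction A rule: infinite_finite_induct)
  case (insert i A)
  then have "max (padic_norm (f i)) (padic_norm (sum f A)) \<le> c" by simp
  then show ?case
    using padic_norm_ultra[of "f i" "sum f A"] insert.hyps by (simp del: max.bounded_iff)
qed (use assms(2) in auto)

lemma padic_val_ge_2_iff:
  "padic_val (x :: 'p::prime_card padic) \<ge> 2 \<longleftrightarrow> padic_norm x \<le> (1 / real CARD('p))\<^sup>2"
proof (cases "x = 0")
  case True
  then show ?thesis by (simp add: padic_val_def)
next
  case False
  let ?p = "real CARD('p)"
  have p1: "?p > 1" by (rule p_gt_1[OF prime_card])
  have pos: "padic_norm x > 0"
    using False padic_norm_nonneg[of x] padic_norm_eq_0_iff[of x] by simp
  have "padic_val x \<ge> 2 \<longleftrightarrow> log ?p (padic_norm x) \<le> - 2"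
    using False by (auto simp: padic_val_def)
  also have "\<dots> \<longleftrightarrow> padic_norm x \<le> ?p powr (- 2)"
    using p1 pos by (rule log_le_iff)
  also have "?p powr (- 2) = (1 / ?p)\<^sup>2"
    using p1 by (simp add: powr_minus powr_numeral power_one_over inverse_eq_divide)
  finally show ?thesis .
qed

section \<open>Truncations of balanced expansions\<close>

text \<open>
  The product of the real and the \<open>p\<close>-adic absolute value of \<open>c / p\<^sup>k\<close> is the modulus of the part
  of \<open>c\<close> that is prime to \<open>p\<close>. This is what makes truncations unique: an element of \<open>\<int>[1/p]\<close> that is small at
  both places vanishes.
\<close>

lemma product_formula_ge_1:
  assumes "prime p" "q \<noteq> 0" "q * of_nat p ^ k \<in> \<int>"
  shows "real_of_rat \<bar>q\<bar> * rat_abs p q \<ge> 1"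
proof -
  obtain c where c: "q * of_nat p ^ k = of_int c" using assms(3) by (auto elim: Ints_cases)
  have p0: "p > 0" using assms(1) by (rule prime_gt_0_nat)
  have q: "q = of_int c / of_nat p ^ k" using c p0 by (simp add: field_simps)
  have c0: "c \<noteq> 0" using q assms(2) by auto
  have "rat_abs p q = rat_abs p (of_int c) * real p ^ k"
    using assms(1) by (simp add: q rat_abs_divide rat_abs_power rat_abs_prime power_one_over)
  moreover have "real_of_rat \<bar>q\<bar> = real_of_int \<bar>c\<bar> / real p ^ k"
    by (simp add: q of_rat_divide of_rat_power abs_divide abs_of_rat[symmetric] flip: of_int_abs)
  ultimately have "real_of_rat \<bar>q\<bar> * rat_abs p q = \<bar>c\<bar> * rat_abs p (of_int c)"
    using p0 by simp
  also have "\<dots> = \<bar>c\<bar> / real p ^ multiplicity (int p) c"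
    using rat_abs_of_int[OF assms(1) c0] by simp
  also have "\<dots> \<ge> 1"
  proof -
    have "int p ^ multiplicity (int p) c \<le> \<bar>c\<bar>"
      using c0 by (intro zdvd_imp_le) (auto simp: multiplicity_dvd)
    then have "real p ^ multiplicity (int p) c \<le> \<bar>c\<bar>"
      by (metis of_int_le_iff of_int_of_nat_eq of_int_power)
    then show ?thesis using p0 by (simp add: field_simps)
  qed
  finally show ?thesis .
qed

text \<open>
  By density the digit may be computed for a rational \<open>c / d\<close> with \<open>d\<close> prime to \<open>p\<close>: it is the
  balanced residue of \<open>c\<close> times an inverse of \<open>d\<close> modulo \<open>p\<close>.
\<close>

lemma integral_padic_has_balanced_digit:
  fixes x :: "'p::prime_card padic"
  assumes "odd CARD('p)" "padic_norm x \<le> 1"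
  shows "\<exists>a\<in>{- ((int CARD('p) - 1) div 2)..(int CARD('p) - 1) div 2}.
    padic_norm (x - of_int a) \<le> 1 / real CARD('p)"
proof -
  define P where "P = int CARD('p)"
  define h where "h = (P - 1) div 2"
  have pr: "prime CARD('p)" by (rule prime_card)
  have P1: "P > 1" using prime_gt_1_nat[OF pr] by (simp add: P_def)
  have P_odd: "P = 2 * h + 1" using assms(1) by (auto simp: P_def h_def elim!: oddE)
  have "1 / real CARD('p) > 0" using prime_gt_0_nat[OF pr] by simp
  then obtain q where q: "padic_norm (x - of_rat q) < 1 / real CARD('p)"
    by (rule rat_dense_padic)
  have inv_le: "1 / real CARD('p) \<le> 1" using prime_gt_0_nat[OF pr] by simp
  have "padic_norm (of_rat q :: 'p padic) \<le> max (padic_norm x) (padic_norm (x - of_rat q))"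
    using padic_norm_ultra_diff[of x "x - of_rat q"] by simp
  then have "padic_norm (of_rat q :: 'p padic) \<le> 1"
    using q inv_le assms(2) by linarith
  then have q1: "rat_abs CARD('p) q \<le> 1" by (simp add: padic_norm_of_rat)
  obtain c d where cd: "quotient_of q = (c, d)" by (cases "quotient_of q")
  have d: "d > 0" and cop: "coprime c d" and qcd: "q = of_int c / of_int d"
    using quotient_of_denom_pos[OF cd] quotient_of_coprime[OF cd] quotient_of_div[OF cd] by auto
  have nd: "\<not> P dvd d"
  proof
    assume dvd: "P dvd d"
    then have "\<not> P dvd c"
      using cop P1 coprime_common_divisor[of c d P] by auto
    then have "rat_abs CARD('p) (of_int c) = 1"
      using rat_abs_of_int_unit[OF pr] by (simp add: P_def)
    moreover have "rat_abs CARD('p) (of_int d) \<le> 1 / real CARD('p)"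
      using rat_abs_of_int_dvd[OF pr] dvd by (simp add: P_def)
    moreover have "1 / real CARD('p) < 1" using P1 by (simp add: P_def)
    moreover have "rat_abs CARD('p) (of_int d) > 0"
      using d rat_abs_nonneg[OF pr, of "of_int d"] rat_abs_eq_0_iff[OF pr, of "of_int d"] by simp
    moreover from calculation have "rat_abs CARD('p) (of_int d) < 1" by linarith
    ultimately have "rat_abs CARD('p) q > 1" by (simp add: qcd rat_abs_divide[OF pr])
    then show False using q1 by simp
  qed
  have "coprime d P"
    using nd pr prime_imp_coprime[of P d] by (simp add: P_def coprime_commute)
  then obtain e where e: "[d * e = 1] (mod P)"
    using cong_solve_coprime_int by blast
  \<comment> \<open>Shifting by \<open>h\<close> before reducing selects the representative in \<open>{-h..h}\<close>.\<close>
  define a where "a = (c * e + h) mod P - h"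
  have a: "a \<in> {-h..h}"
    using pos_mod_bound[of P "c * e + h"] pos_mod_sign[of P "c * e + h"] P1 P_odd
    by (simp add: a_def)
  have "P dvd c - d * a"
  proof -
    have "[a = c * e + h - h] (mod P)"
      unfolding a_def by (intro cong_diff cong_refl) (simp add: cong_def)
    then have "[d * a = d * (c * e)] (mod P)" by (intro cong_scalar_left) simp
    also have "[d * (c * e) = c * 1] (mod P)"
      using cong_scalar_left[OF e, of c] by (simp add: ac_simps)
    finally show ?thesis by (simp add: cong_iff_dvd_diff dvd_diff_commute)
  qed
  then have "rat_abs CARD('p) (of_int (c - d * a)) \<le> 1 / real CARD('p)"
    unfolding P_def by (rule rat_abs_of_int_dvd[OF pr])
  moreover have "q - of_int a = of_int (c - d * a) / of_int d"
    using d by (simp add: qcd field_simps)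
  moreover have "rat_abs CARD('p) (of_int d) = 1"
    using rat_abs_of_int_unit[OF pr] nd by (simp add: P_def)
  ultimately have "rat_abs CARD('p) (q - of_int a) \<le> 1 / real CARD('p)"
    by (simp only: rat_abs_divide[OF pr] div_by_1)
  then have "padic_norm (of_rat q - of_int a :: 'p padic) \<le> 1 / real CARD('p)"
    using padic_norm_of_rat[where 'p = 'p, of "q - of_int a"] by (simp add: of_rat_diff)
  then have "padic_norm (x - of_int a) \<le> 1 / real CARD('p)"
    using padic_norm_ultra[of "x - of_rat q" "of_rat q - of_int a"] q by simp
  with a show ?thesis by (auto simp: h_def P_def)
qed

text \<open>
  Existence is needed because \<^const>\<open>browkin_s\<close> and \<^const>\<open>browkin_t\<close> are definite descriptions over
  all expansions. The digits are split off one at a time from \<open>x p\<^sup>r\<close>, where \<open>r\<close> is large enough to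
  clear the pole of \<open>x\<close>.
\<close>

lemma balanced_expansion_exists:
  fixes x :: "'p::prime_card padic"
  assumes "odd CARD('p)"
  shows "\<exists>r a. balanced_expansion x r a"
proof -
  define P :: "'p padic" where "P = of_nat CARD('p)"
  define h where "h = (int CARD('p) - 1) div 2"
  have p1: "real CARD('p) > 1" by (rule p_gt_1[OF prime_card])
  have P0: "P \<noteq> 0" using p1 by (simp add: P_def)
  have normP: "padic_norm P = 1 / real CARD('p)" by (simp add: P_def padic_norm_prime)
  obtain r where r: "padic_norm x < real CARD('p) ^ r"
    using real_arch_pow[OF p1] by blast
  obtain dig :: "'p padic \<Rightarrow> int" where dig: "\<And>y. padic_norm y \<le> 1 \<Longrightarrow>
      dig y \<in> {-h..h} \<and> padic_norm (y - of_int (dig y)) \<le> 1 / real CARD('p)"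
    using integral_padic_has_balanced_digit[OF assms] unfolding h_def by metis
  define y where "y = rec_nat (x * P ^ r) (\<lambda>_ z. (z - of_int (dig z)) / P)"
  have y_Suc: "y (Suc k) = (y k - of_int (dig (y k))) / P" for k by (simp add: y_def)
  have y_le: "padic_norm (y k) \<le> 1" for k
  proof (induction k)
    case 0
    show ?case using r p1
      by (simp add: y_def padic_norm_mult padic_norm_power normP power_one_over divide_le_eq)
  next
    case (Suc k)
    then show ?case using dig[OF Suc] p1
      by (simp add: y_Suc padic_norm_divide normP field_simps)
  qed
  define a where "a n = dig (y (nat (n + int r)))" for n
  \<comment> \<open>The remainder \<open>y k\<close> stays integral, so the error term has norm at most \<open>p\<close> to the \<open>r - k\<close>.\<close>
  have expand: "x = (\<Sum>n\<in>{- int r..int k - int r - 1}. of_int (a n) * P powi n) + P powi (int k - int r) * y k" for k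
  proof (induction k)
    case 0
    show ?case using P0 by (simp add: y_def power_int_minus)
  next
    case (Suc k)
    have set: "{- int r..int (Suc k) - int r - 1} = insert (int k - int r) {- int r..int k - int r - 1}"
      by auto
    have "P powi (int (Suc k) - int r) = P powi (int k - int r) * P"
      using P0 power_int_add_1[of P "int k - int r"] by (simp add: algebra_simps)
    then have "P powi (int (Suc k) - int r) * y (Suc k) = P powi (int k - int r) * (y k - of_int (a (int k - int r)))"
      using P0 by (simp add: y_Suc a_def)
    then show ?case
      unfolding set by (subst sum.insert) (use Suc.IH in \<open>auto simp: algebra_simps\<close>)
  qed
  have "balanced_expansion x (int r) a"
    unfolding balanced_expansion_def
  proof (intro conjI allI impI)
    fix n
    show "a n \<in> {- ((int CARD('p) - 1) div 2) .. (int CARD('p) - 1) div 2}"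
      using dig[OF y_le] by (simp add: a_def h_def)
  next
    let ?S = "\<lambda>N. \<Sum>n\<in>{- int r..int N}. of_int (a n) * P powi n"
    have "dist (?S N) x \<le> (1 / real CARD('p)) ^ Suc N" for N
    proof -
      have "?S N - x = - (P powi int (Suc N) * y (Suc N + r))"
        using expand[of "Suc N + r"] by (simp add: algebra_simps)
      then have "dist (?S N) x = (1 / real CARD('p)) ^ Suc N * padic_norm (y (Suc N + r))"
        by (simp only: dist_padic_def padic_norm_minus padic_norm_mult padic_norm_power_int normP
              power_int_of_nat padic_norm_power)
      also have "\<dots> \<le> (1 / real CARD('p)) ^ Suc N * 1"
        by (intro mult_left_mono y_le) simp
      finally show ?thesis by simp
    qed
    then have bound: "norm (dist (?S N) x) \<le> (1 / real CARD('p)) ^ Suc N" for N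
      by (simp only: real_norm_def abs_of_nonneg[OF zero_le_dist])
    have "(\<lambda>N. (1 / real CARD('p)) ^ Suc N) \<longlonglongrightarrow> 0"
      using p1 by (intro LIMSEQ_Suc LIMSEQ_realpow_zero) auto
    then have "(\<lambda>N. dist (?S N) x) \<longlonglongrightarrow> 0"
      by (rule Lim_null_comparison[OF always_eventually[OF allI[OF bound]]])
    then show "(\<lambda>N. \<Sum>n\<in>{- int r..int N}. of_int (a n) * of_nat CARD('p) powi n) \<longlonglongrightarrow> x"
      unfolding P_def by (rule tendsto_dist_iff[THEN iffD2])
  qed
  then show ?thesis by blast
qed

lemma of_rat_of_nat_power_int:
  "(of_rat (of_nat n powi k) :: 'a::field_char_0) = of_nat n powi k"
  by (simp add: power_int_def of_rat_power of_rat_inverse)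

text \<open>
  The truncation of \<open>x\<close> after the digit of \<open>p\<^sup>j\<close>, characterised without digits: \<^const>\<open>browkin_s\<close> is
  the case \<open>j = 0\<close> and \<^const>\<open>browkin_t\<close> the case \<open>j = - 1\<close>.
\<close>

definition balanced_truncation :: "int \<Rightarrow> 'p::prime_card padic \<Rightarrow> rat \<Rightarrow> bool" where
  "balanced_truncation j x q \<longleftrightarrow>
     (\<exists>k. q * of_nat CARD('p) ^ k \<in> \<int>) \<and>
     2 * \<bar>q\<bar> < of_nat CARD('p) powi (j + 1) \<and>
     padic_norm (x - of_rat q) \<le> real CARD('p) powi (- (j + 1))"

lemma balanced_truncation_unique:
  fixes x :: "'p::prime_card padic"
  assumes "balanced_truncation j x q" "balanced_truncation j x q'"
  shows "q = q'"
proof (rule ccontr)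
  assume ne: "q \<noteq> q'"
  define P where "P = CARD('p)"
  have pr: "prime P" by (simp add: P_def prime_card)
  have P0: "real P > 0" using prime_gt_0_nat[OF pr] by simp
  obtain k k' where k: "q * of_nat P ^ k \<in> \<int>" "q' * of_nat P ^ k' \<in> \<int>"
    using assms unfolding balanced_truncation_def P_def by auto
  have "(q - q') * of_nat P ^ (k + k')
      = q * of_nat P ^ k * of_nat P ^ k' - q' * of_nat P ^ k' * of_nat P ^ k"
    by (simp add: algebra_simps power_add)
  also have "\<dots> \<in> \<int>" by (intro Ints_diff Ints_mult k) auto
  finally have 1: "1 \<le> real_of_rat \<bar>q - q'\<bar> * rat_abs P (q - q')"
    using product_formula_ge_1[OF pr, of "q - q'"] ne by simp
  have "2 * \<bar>q - q'\<bar> \<le> 2 * \<bar>q\<bar> + 2 * \<bar>q'\<bar>"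
    using mult_left_mono[OF abs_triangle_ineq4[of q q'], of 2] by (simp only: distrib_left)
  also have "\<dots> < 2 * of_nat P powi (j + 1)"
    using assms unfolding balanced_truncation_def P_def by simp
  finally have "\<bar>q - q'\<bar> < of_nat P powi (j + 1)" by simp
  then have "real_of_rat \<bar>q - q'\<bar> < real_of_rat (of_nat P powi (j + 1))"
    by (simp only: of_rat_less)
  also have "real_of_rat (of_nat P powi (j + 1)) = real P powi (j + 1)"
    by (rule of_rat_of_nat_power_int)
  finally have 2: "real_of_rat \<bar>q - q'\<bar> < real P powi (j + 1)" .
  have "rat_abs P (q - q') = padic_norm (of_rat (q - q') :: 'p padic)"
    by (simp add: padic_norm_of_rat P_def)
  also have "(of_rat (q - q') :: 'p padic) = (x - of_rat q') - (x - of_rat q)"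
    by (simp add: of_rat_diff)
  also have "padic_norm \<dots> \<le> real P powi (- (j + 1))"
    using padic_norm_ultra_diff[of "x - of_rat q'" "x - of_rat q"] assms
    unfolding balanced_truncation_def P_def by linarith
  finally have "real_of_rat \<bar>q - q'\<bar> * rat_abs P (q - q') \<le> real_of_rat \<bar>q - q'\<bar> * real P powi (- (j + 1))"
    by (intro mult_left_mono) auto
  also have "\<dots> < real P powi (j + 1) * real P powi (- (j + 1))"
    using 2 P0 by (intro mult_strict_right_mono) auto
  also have "\<dots> = 1" using P0 by (subst power_int_add[symmetric]) auto
  finally show False using 1 by simp
qed

text \<open>
  The real bound is the geometric series: a finite sum with digits of modulus at most
  \<open>(p - 1) / 2\<close> stays strictly below half of the next power of \<open>p\<close>.
\<close>

lemma two_times_balanced_sum_less: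
  fixes a :: "int \<Rightarrow> int"
  assumes "p > 0" "\<And>n. n \<ge> -r \<Longrightarrow> 2 * \<bar>a n\<bar> < int p"
  shows "2 * \<bar>\<Sum>n\<in>{-r..j}. of_int (a n) * of_nat p powi n\<bar> < (of_nat p powi (j + 1) :: rat)"
proof (cases "j \<ge> -r - 1")
  case True
  let ?P = "of_nat p :: rat"
  have P0: "?P > 0" using assms(1) by simp
  show ?thesis using True
  proof (induction j rule: int_ge_induct)
    case base
    show ?case using P0 by simp
  next
    case (step j)
    let ?S = "\<Sum>n\<in>{-r..j}. of_int (a n) * ?P powi n"
    have set: "{-r..j + 1} = insert (j + 1) {-r..j}" using step.hyps by auto
    have "2 * \<bar>a (j + 1)\<bar> \<le> int p - 1" using assms(2)[of "j + 1"] step.hyps by simp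
    then have "(of_int (2 * \<bar>a (j + 1)\<bar>) :: rat) \<le> of_int (int p - 1)"
      by (simp only: of_int_le_iff)
    then have "2 * \<bar>of_int (a (j + 1))\<bar> \<le> ?P - 1" by simp
    then have digit: "2 * \<bar>of_int (a (j + 1))\<bar> * ?P powi (j + 1) \<le> (?P - 1) * ?P powi (j + 1)"
      using P0 by (intro mult_right_mono) auto
    have "2 * \<bar>of_int (a (j + 1)) * ?P powi (j + 1) + ?S\<bar>
        \<le> 2 * \<bar>of_int (a (j + 1)) * ?P powi (j + 1)\<bar> + 2 * \<bar>?S\<bar>"
      unfolding distrib_left[symmetric] by (intro mult_left_mono abs_triangle_ineq) simp
    also have "\<dots> < (?P - 1) * ?P powi (j + 1) + ?P powi (j + 1)"
      using add_le_less_mono[OF digit step.IH] P0 by (simp add: abs_mult mult.assoc)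
    also have "\<dots> = ?P powi (j + 1 + 1)"
      using P0 power_int_add_1[of ?P "j + 1"] by (simp add: algebra_simps)
    finally show ?case unfolding set by (subst sum.insert) auto
  qed
next
  case False
  then show ?thesis using assms(1) by simp
qed

lemma balanced_expansion_truncation:
  fixes x :: "'p::prime_card padic"
  assumes "odd CARD('p)" "balanced_expansion x r a"
  shows "balanced_truncation j x (\<Sum>n\<in>{-r..j}. of_int (a n) * of_nat CARD('p) powi n)"
    (is "balanced_truncation j x ?q")
proof -
  let ?P = "of_nat CARD('p) :: 'p padic"
  have p1: "real CARD('p) > 1" by (rule p_gt_1[OF prime_card])
  have dig: "2 * \<bar>a n\<bar> < int CARD('p)" if "n \<ge> -r" for n
    using assms that unfolding balanced_expansion_def by (auto elim!: oddE)
  have lim: "(\<lambda>N. \<Sum>n\<in>{-r..int N}. of_int (a n) * ?P powi n) \<longlonglongrightarrow> x"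
    using assms(2) unfolding balanced_expansion_def by blast
  have int: "?q * of_nat CARD('p) ^ nat r \<in> \<int>"
    unfolding sum_distrib_right
  proof (rule Ints_sum)
    fix n assume n: "n \<in> {-r..j}"
    have "(of_nat CARD('p) :: rat) powi n * of_nat CARD('p) ^ nat r = of_nat CARD('p) powi (n + int (nat r))"
      using p1 by (subst power_int_add) (auto simp: power_int_def)
    also have "\<dots> = of_nat CARD('p) ^ nat (n + int (nat r))"
      using n by (auto simp: power_int_def)
    finally show "of_int (a n) * of_nat CARD('p) powi n * of_nat CARD('p) ^ nat r \<in> (\<int> :: rat set)"
      by (simp add: mult.assoc)
  qed
  have "padic_norm (x - of_rat ?q) \<le> real CARD('p) powi (- (j + 1))"
  proof (rule LIMSEQ_le_const2)
    have q: "of_rat ?q = (\<Sum>n\<in>{-r..j}. of_int (a n) * ?P powi n)"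
      by (simp add: of_rat_sum of_rat_mult of_rat_of_nat_power_int)
    have "(\<lambda>N. dist (\<Sum>n\<in>{-r..int N}. of_int (a n) * ?P powi n) (of_rat ?q)) \<longlonglongrightarrow> dist x (of_rat ?q)"
      by (intro tendsto_dist lim tendsto_const)
    then show "(\<lambda>N. dist (\<Sum>n\<in>{-r..int N}. of_int (a n) * ?P powi n) (of_rat ?q))
        \<longlonglongrightarrow> padic_norm (x - of_rat ?q)"
      by (simp add: dist_padic_def)
    have "dist (\<Sum>n\<in>{-r..int N}. of_int (a n) * ?P powi n) (of_rat ?q) \<le> real CARD('p) powi (- (j + 1))"
      if N: "N \<ge> nat j" for N
    proof -
      have "(\<Sum>n\<in>{-r..int N}. of_int (a n) * ?P powi n) - of_rat ?q
          = (\<Sum>n\<in>{-r..int N} - {-r..j}. of_int (a n) * ?P powi n)"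
        unfolding q using N by (subst sum_diff) auto
      also have "padic_norm \<dots> \<le> real CARD('p) powi (- (j + 1))"
      proof (rule padic_norm_sum_le)
        fix n assume "n \<in> {-r..int N} - {-r..j}"
        then have n: "n \<ge> j + 1" by auto
        have "padic_norm (of_int (a n) * ?P powi n)
            = rat_abs CARD('p) (of_int (a n)) * real CARD('p) powi (- n)"
          by (simp add: padic_norm_mult padic_norm_power_int padic_norm_prime padic_norm_of_int
              power_int_minus power_int_one_over inverse_eq_divide)
        also have "\<dots> \<le> 1 * real CARD('p) powi (- n)"
          by (intro mult_right_mono rat_abs_of_int_le_1[OF prime_card]) auto
        also have "\<dots> \<le> real CARD('p) powi (- (j + 1))"
          using n p1 by (simp add: power_int_increasing)
        finally show "padic_norm (of_int (a n) * ?P powi n) \<le> real CARD('p) powi (- (j + 1))" .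
      qed simp
      finally show ?thesis by (simp add: dist_padic_def)
    qed
    then show "\<exists>N0. \<forall>N\<ge>N0. dist (\<Sum>n\<in>{-r..int N}. of_int (a n) * ?P powi n) (of_rat ?q)
        \<le> real CARD('p) powi (- (j + 1))" by blast
  qed
  moreover have "2 * \<bar>?q\<bar> < of_nat CARD('p) powi (j + 1)"
    using two_times_balanced_sum_less[of "CARD('p)" r a j] dig p1 by simp
  ultimately show ?thesis unfolding balanced_truncation_def using int by blast
qed

text \<open>
  A truncation can thus be recognised by its size at the two places, and no expansion of \<open>x\<close> or of
  \<open>q\<close> has to be written down.
\<close>

lemma THE_truncation_eq:
  fixes x :: "'p::prime_card padic"
  assumes "odd CARD('p)" "balanced_truncation j x q"
  shows "(THE q :: rat. \<exists>r a. balanced_expansion x r a \<and>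
    q = (\<Sum>n\<in>{-r..j}. of_int (a n) * of_nat CARD('p) powi n)) = q"
proof (rule the_equality)
  obtain r a where "balanced_expansion x r a"
    using balanced_expansion_exists[OF assms(1)] by blast
  with balanced_truncation_unique[OF assms(2) balanced_expansion_truncation[OF assms(1)]]
  show "\<exists>r a. balanced_expansion x r a \<and> q = (\<Sum>n\<in>{-r..j}. of_int (a n) * of_nat CARD('p) powi n)"
    by blast
next
  fix q' :: rat
  assume "\<exists>r a. balanced_expansion x r a \<and> q' = (\<Sum>n\<in>{-r..j}. of_int (a n) * of_nat CARD('p) powi n)"
  then show "q' = q"
    using balanced_truncation_unique[OF _ assms(2)] balanced_expansion_truncation[OF assms(1)]
    by blast
qed

lemma browkin_s_eqI:
  fixes x :: "'p::prime_card padic"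
  assumes "odd CARD('p)" "q * of_nat CARD('p) ^ k \<in> \<int>" "2 * \<bar>q\<bar> < of_nat CARD('p)"
    "padic_norm (x - of_rat q) \<le> 1 / real CARD('p)"
  shows "browkin_s x = q"
  unfolding browkin_s_def
  by (rule THE_truncation_eq[OF assms(1)])
    (use assms in \<open>auto simp: balanced_truncation_def power_int_minus inverse_eq_divide\<close>)

lemma browkin_t_eqI:
  fixes x :: "'p::prime_card padic"
  assumes "odd CARD('p)" "q * of_nat CARD('p) ^ k \<in> \<int>" "2 * \<bar>q\<bar> < 1"
    "padic_norm (x - of_rat q) \<le> 1"
  shows "browkin_t x = q"
  unfolding browkin_t_def
  by (rule THE_truncation_eq[OF assms(1)])
    (use assms in \<open>auto simp: balanced_truncation_def\<close>)

section \<open>Square roots of one-units\<close>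

lemma padic_Cauchy_if_increments_small:
  assumes "prime p" "0 \<le> c" "c < 1" "\<And>n. rat_abs p (X (Suc n) - X n) \<le> c ^ n"
  shows "padic_Cauchy p X"
proof -
  have near: "rat_abs p (X (n + k) - X n) \<le> c ^ n" for n k
  proof (induction k)
    case 0
    show ?case using assms(1,2) by (simp add: rat_abs_0)
  next
    case (Suc k)
    have "c ^ (n + k) \<le> c ^ n" using assms(2,3) by (intro power_decreasing) auto
    then show ?case
      using rat_abs_ultra[OF assms(1), of "X (Suc (n + k)) - X (n + k)" "X (n + k) - X n"]
        assms(4)[of "n + k"] Suc by (simp del: max.bounded_iff)
  qed
  show ?thesis unfolding padic_Cauchy_def
  proof (intro allI impI)
    fix e :: real assume "e > 0"
    then obtain N where N: "c ^ N < e" using real_arch_pow_inv[of e c] assms(3) by blast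
    have "rat_abs p (X m - X n) < e" if "m \<ge> N" "n \<ge> N" for m n
    proof -
      have "rat_abs p (X m - X N) \<le> c ^ N" "rat_abs p (X N - X n) \<le> c ^ N"
        using near[of N "m - N"] near[of N "n - N"] that rat_abs_minus_commute[OF assms(1)] by auto
      then show ?thesis
        using rat_abs_ultra[OF assms(1), of "X m - X N" "X N - X n"] N by simp
    qed
    then show "\<exists>N. \<forall>m\<ge>N. \<forall>n\<ge>N. rat_abs p (X m - X n) < e" by blast
  qed
qed

text \<open>
  The map \<open>x \<mapsto> x - (x\<^sup>2 - a) / 2\<close> fixes exactly the square roots of \<open>a\<close>, and it contracts the residue
  class of \<open>1\<close>, because two images differ by \<open>(x - y) (1 - (x + y) / 2)\<close> and the second factor is a
  multiple of \<open>p\<close>. Iterating it on rationals gives a Cauchy sequence representing the root.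
\<close>

lemma one_unit_has_sqrt:
  fixes a :: rat
  assumes "odd CARD('p::prime_card)" "rat_abs CARD('p) (a - 1) < 1"
  shows "\<exists>x :: 'p padic. x\<^sup>2 = of_rat a \<and> padic_norm (x - 1) < 1"
proof -
  define c where "c = rat_abs CARD('p) (a - 1)"
  have pr: "prime CARD('p)" by (rule prime_card)
  have c: "0 \<le> c" "c < 1" using assms(2) by (auto simp: c_def rat_abs_nonneg[OF pr])
  have two: "rat_abs CARD('p) 2 = 1"
    using rat_abs_of_int_unit[OF pr odd_prime_not_dvd_2[OF pr assms(1)]] by simp
  define X where "X = rec_nat 1 (\<lambda>_ x. x - (x\<^sup>2 - a) / 2)"
  have X_Suc: "X (Suc n) = X n - ((X n)\<^sup>2 - a) / 2" for n by (simp add: X_def)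
  note ultra = rat_abs_ultra[OF pr] and mult = rat_abs_mult[OF pr] and
    minus = rat_abs_minus[OF pr] and div = rat_abs_divide[OF pr]
  have X1: "rat_abs CARD('p) (X n - 1) \<le> c" for n
  proof (induction n)
    case 0
    show ?case using c by (simp add: X_def rat_abs_0[OF pr])
  next
    case (Suc n)
    have "X (Suc n) - 1 = ((a - 1) + - ((X n - 1) * (X n - 1))) / 2"
      by (simp add: X_Suc field_simps power2_eq_square)
    then have "rat_abs CARD('p) (X (Suc n) - 1)
        \<le> max c (rat_abs CARD('p) (X n - 1) * rat_abs CARD('p) (X n - 1))"
      using ultra[of "a - 1" "- ((X n - 1) * (X n - 1))"] by (simp only: div two minus mult c_def div_by_1)
    moreover have "rat_abs CARD('p) (X n - 1) * rat_abs CARD('p) (X n - 1) \<le> c * 1"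
      using Suc c by (intro mult_mono) (auto simp: rat_abs_nonneg[OF pr])
    ultimately show ?case by simp
  qed
  have incr: "rat_abs CARD('p) (X (Suc n) - X n) \<le> c ^ n" for n
  proof (induction n)
    case 0
    have "rat_abs CARD('p) (X (Suc 0) - X 0) = rat_abs CARD('p) (X (Suc 0) - 1)"
      by (simp add: X_def)
    also have "\<dots> \<le> c" by (rule X1)
    finally show ?case using c by simp
  next
    case (Suc n)
    let ?s = "(X (Suc n) - 1) + (X n - 1)"
    have "X (Suc (Suc n)) - X (Suc n) = - ((X (Suc n) - X n) * ?s / 2)"
      by (simp add: X_Suc[of "Suc n"]) (simp add: X_Suc[of n] field_simps power2_eq_square)
    then have "rat_abs CARD('p) (X (Suc (Suc n)) - X (Suc n))
        = rat_abs CARD('p) (X (Suc n) - X n) * rat_abs CARD('p) ?s"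
      by (simp only: minus div mult two div_by_1 mult_1_left)
    also have "\<dots> \<le> c ^ n * c"
      using ultra[of "X (Suc n) - 1" "X n - 1"] X1[of n] X1[of "Suc n"] c Suc
      by (intro mult_mono) (auto simp: rat_abs_nonneg[OF pr] simp del: max.bounded_iff)
    finally show ?case by (simp add: mult.commute)
  qed
  have C: "padic_Cauchy CARD('p) X"
    by (rule padic_Cauchy_if_increments_small[OF pr c incr])
  have CC: "padic_Cauchy CARD('p) (\<lambda>n. X n * X n)"
    by (rule padic_Cauchy_mult[OF pr C C])
  define x where "x = (abs_padic X :: 'p padic)"
  have sub: "padic_Cauchy CARD('p) (\<lambda>n. Y n - q)" if "padic_Cauchy CARD('p) Y" for Y q
    using padic_Cauchy_add[OF pr that padic_Cauchy_const[OF pr], of "- q"] by simp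
  have "x * x = abs_padic (\<lambda>n. X n * X n)"
    unfolding x_def by (rule times_padic.abs_eq) (simp_all add: padic_rel_refl pr C)
  then have "x\<^sup>2 - of_rat a = abs_padic (\<lambda>n. X n * X n - a)"
    using abs_padic_diff_of_rat[OF CC] by (simp add: power2_eq_square)
  then have lim: "(\<lambda>n. rat_abs CARD('p) (X n * X n - a)) \<longlonglongrightarrow> padic_norm (x\<^sup>2 - of_rat a)"
    using padic_norm_abs_padic[OF sub[OF CC]] by simp
  have "rat_abs CARD('p) (X n * X n - a) \<le> c ^ n" for n
  proof -
    have "X n * X n - a = - (2 * (X (Suc n) - X n))"
      by (simp add: X_Suc power2_eq_square)
    then have "rat_abs CARD('p) (X n * X n - a) = rat_abs CARD('p) (X (Suc n) - X n)"
      by (simp only: minus mult two div_by_1 mult_1_left)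
    then show ?thesis using incr by simp
  qed
  then have "(\<lambda>n. rat_abs CARD('p) (X n * X n - a)) \<longlonglongrightarrow> 0"
    using LIMSEQ_realpow_zero[OF c] by (intro rat_abs_tendsto_0_le[OF pr]) auto
  then have "padic_norm (x\<^sup>2 - of_rat a) = 0"
    using lim LIMSEQ_unique by blast
  then have "x\<^sup>2 = of_rat a" by (simp add: padic_norm_eq_0_iff)
  moreover have "padic_norm (x - 1) \<le> c"
  proof (rule LIMSEQ_le_const2)
    show "(\<lambda>n. rat_abs CARD('p) (X n - 1)) \<longlonglongrightarrow> padic_norm (x - 1)"
      using padic_norm_abs_padic[OF sub[OF C]] abs_padic_diff_of_rat[OF C, of 1]
      by (simp add: x_def)
  qed (use X1 in blast)
  ultimately show ?thesis using c by (intro exI[of _ x]) simp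
qed

section \<open>Continued fractions from complete quotients\<close>

lemma padic_norm_inverse_diff:
  fixes y z :: "'p::prime_card padic"
  assumes "padic_norm (y - z) < padic_norm z"
  shows "padic_norm (1 / y - 1 / z) = padic_norm (y - z) / (padic_norm z)\<^sup>2"
proof -
  from padic_norm_add_eq[OF assms] have y: "padic_norm y = padic_norm z" by simp
  have "z \<noteq> 0" using assms padic_norm_nonneg[of "y - z"] by auto
  moreover from this have "y \<noteq> 0" using y by (auto simp: padic_norm_eq_0_iff)
  ultimately have "1 / y - 1 / z = - (y - z) / (y * z)" by (simp add: field_simps)
  then show ?thesis
    by (simp only: padic_norm_divide padic_norm_minus padic_norm_mult y power2_eq_square)
qed

text \<open>
  Replacing the complete quotient \<open>\<alpha> (k + j + 1)\<close> by infinity changes \<open>\<alpha> k\<close> very little: passing from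
  the tail at \<open>k + 1\<close> to the one at \<open>k\<close> inverts, which divides the error by the squared norm of
  \<open>\<alpha> (k + 1)\<close>. The hypothesis on the product of consecutive norms makes the error at \<open>k + 1\<close> smaller
  in norm than \<open>\<alpha> (k + 1)\<close> itself, so that no tail of a convergent vanishes. The induction is on the length of the
  tail, for all starting points at once.
\<close>

lemma cfrac_eval_error:
  fixes \<alpha> :: "nat \<Rightarrow> 'p::prime_card padic"
  assumes rec: "\<And>n. \<alpha> n = of_rat (b n) + 1 / \<alpha> (Suc n)"
    and grow: "\<And>n. c \<le> padic_norm (\<alpha> (Suc n)) * padic_norm (\<alpha> (Suc (Suc n)))"
    and c: "c > 1"
  shows "padic_norm (of_rat (cfrac_eval (map b [k..<Suc (k + j)])) - \<alpha> k)
    \<le> 1 / (padic_norm (\<alpha> (Suc k)) * c ^ j)"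
proof (induction j arbitrary: k)
  case 0
  have "of_rat (b k) - \<alpha> k = - (1 / \<alpha> (Suc k))" using rec[of k] by simp
  then have "padic_norm (of_rat (b k) - \<alpha> k) = 1 / padic_norm (\<alpha> (Suc k))"
    by (simp only: padic_norm_minus padic_norm_divide padic_norm_1)
  then show ?case by simp
next
  case (Suc j)
  define y where "y = (of_rat (cfrac_eval (map b [Suc k..<Suc (Suc k + j)])) :: 'p padic)"
  let ?z = "\<alpha> (Suc k)"
  have pos: "padic_norm (\<alpha> (Suc n)) > 0" for n
    using grow[of n] c padic_norm_nonneg[of "\<alpha> (Suc n)"]
    by (cases "padic_norm (\<alpha> (Suc n)) = 0") auto
  have "padic_norm (y - ?z) \<le> 1 / (padic_norm (\<alpha> (Suc (Suc k))) * c ^ j)"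
    unfolding y_def by (rule Suc.IH)
  also have "\<dots> \<le> padic_norm ?z / c ^ Suc j"
  proof -
    have "c * c ^ j \<le> padic_norm ?z * padic_norm (\<alpha> (Suc (Suc k))) * c ^ j"
      using grow[of k] c by (intro mult_right_mono) auto
    then show ?thesis using pos[of "Suc k"] c by (simp add: field_simps)
  qed
  finally have near: "padic_norm (y - ?z) \<le> padic_norm ?z / c ^ Suc j" .
  have "1 < c ^ Suc j" using c by (intro one_less_power) auto
  then have "padic_norm ?z / c ^ Suc j < padic_norm ?z"
    using pos[of k] by (simp add: divide_less_eq)
  with near have less: "padic_norm (y - ?z) < padic_norm ?z" by simp
  have list: "[k..<Suc (k + Suc j)] = k # Suc k # [Suc (Suc k)..<Suc (Suc k + j)]"
    "[Suc k..<Suc (Suc k + j)] = Suc k # [Suc (Suc k)..<Suc (Suc k + j)]"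
    by (simp_all add: upt_conv_Cons del: upt_Suc)
  have "of_rat (cfrac_eval (map b [k..<Suc (k + Suc j)])) = of_rat (b k) + 1 / y"
    unfolding y_def list by (simp add: of_rat_add of_rat_divide del: upt_Suc)
  then have "of_rat (cfrac_eval (map b [k..<Suc (k + Suc j)])) - \<alpha> k = 1 / y - 1 / ?z"
    using rec[of k] by simp
  then have "padic_norm (of_rat (cfrac_eval (map b [k..<Suc (k + Suc j)])) - \<alpha> k)
      = padic_norm (y - ?z) / (padic_norm ?z)\<^sup>2"
    by (simp only: padic_norm_inverse_diff[OF less])
  also have "\<dots> \<le> padic_norm ?z / c ^ Suc j / (padic_norm ?z)\<^sup>2"
    using near by (intro divide_right_mono) auto
  also have "\<dots> = 1 / (padic_norm ?z * c ^ Suc j)"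
    using pos[of k] c by (simp add: field_simps power2_eq_square)
  finally show ?case .
qed

lemma cfrac_value_of_complete_quotients:
  fixes \<alpha> :: "nat \<Rightarrow> 'p::prime_card padic"
  assumes rec: "\<And>n. \<alpha> n = of_rat (b n) + 1 / \<alpha> (Suc n)"
    and grow: "\<And>n. c \<le> padic_norm (\<alpha> (Suc n)) * padic_norm (\<alpha> (Suc (Suc n)))"
    and c: "c > 1"
  shows "cfrac_value b (\<alpha> 0)"
proof -
  let ?C = "\<lambda>n. of_rat (cfrac_eval (map b [0..<Suc n])) :: 'p padic"
  have bound: "norm (dist (?C j) (\<alpha> 0)) \<le> 1 / padic_norm (\<alpha> 1) * (1 / c) ^ j" for j
    using cfrac_eval_error[of \<alpha> b c 0 j, OF rec grow c]
    by (simp add: dist_padic_def power_one_over padic_norm_nonneg del: upt_Suc)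
  have "(\<lambda>j. 1 / padic_norm (\<alpha> 1) * (1 / c) ^ j) \<longlonglongrightarrow> 0"
    using c by (intro tendsto_mult_right_zero LIMSEQ_realpow_zero) auto
  then have "(\<lambda>j. dist (?C j) (\<alpha> 0)) \<longlonglongrightarrow> 0"
    by (rule Lim_null_comparison[OF always_eventually[OF allI[OF bound]]])
  then show ?thesis
    unfolding cfrac_value_def by (rule tendsto_dist_iff[THEN iffD2])
qed

lemma browkin2_eq_Some:
  fixes \<alpha> :: "nat \<Rightarrow> 'p::prime_card padic"
  assumes rec: "\<And>n. \<alpha> n = of_rat (b n) + 1 / \<alpha> (Suc n)"
    and nz: "\<And>n. \<alpha> (Suc n) \<noteq> 0"
    and quot: "\<And>n. browkin2_quotient n (\<alpha> n) = b n"
  shows "browkin2 (\<alpha> 0) n = Some (b n)"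
proof -
  have "browkin2_complete (\<alpha> 0) n = Some (\<alpha> n)"
  proof (induction n)
    case (Suc n)
    have "\<alpha> n - of_rat (b n) = 1 / \<alpha> (Suc n)" using rec[of n] by simp
    moreover from this have "\<alpha> n \<noteq> of_rat (b n)" using nz[of n] by auto
    ultimately show ?case by (simp add: Suc quot Let_def)
  qed simp
  then show ?thesis by (simp add: browkin2_def quot)
qed

section \<open>The periodic expansion\<close>

lemma eventually_periodic_map:
  assumes "vs \<noteq> []"
  shows "eventually_periodic (map f us) (map f vs) n = f (eventually_periodic us vs n)"
  using assms by (simp add: eventually_periodic_def)

text \<open>
  The expansion has pre-period two and period four. The last equation closes the period, so that a
  relation between consecutive terms reduces to six identities. All arguments are written with
  \<^const>\<open>Suc\<close> so that they match the shape of \<open>n\<close> and \<open>Suc n\<close> syntactically.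
\<close>

lemma eventually_periodic_2_4:
  "eventually_periodic [u0, u1] [v0, v1, v2, v3] 0 = u0"
  "eventually_periodic [u0, u1] [v0, v1, v2, v3] (Suc 0) = u1"
  "eventually_periodic [u0, u1] [v0, v1, v2, v3] (Suc (Suc 0)) = v0"
  "eventually_periodic [u0, u1] [v0, v1, v2, v3] (Suc (Suc (4 * k))) = v0"
  "eventually_periodic [u0, u1] [v0, v1, v2, v3] (Suc (Suc (Suc (4 * k)))) = v1"
  "eventually_periodic [u0, u1] [v0, v1, v2, v3] (Suc (Suc (Suc (Suc (4 * k))))) = v2"
  "eventually_periodic [u0, u1] [v0, v1, v2, v3] (Suc (Suc (Suc (Suc (Suc (4 * k)))))) = v3"
  "eventually_periodic [u0, u1] [v0, v1, v2, v3] (Suc (Suc (Suc (Suc (Suc (Suc (4 * k))))))) = v0"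
  by (simp_all add: eventually_periodic_def mod_Suc)

lemma cases_2_4:
  obtains "n = 0" | "n = Suc 0" | k where "n = Suc (Suc (4 * k))" | k where "n = Suc (Suc (Suc (4 * k)))"
  | k where "n = Suc (Suc (Suc (Suc (4 * k))))" | k where "n = Suc (Suc (Suc (Suc (Suc (4 * k)))))"
proof -
  have "n = 0 \<or> n = 1 \<or> (\<exists>k. n = 4 * k + 2) \<or> (\<exists>k. n = 4 * k + 3) \<or> (\<exists>k. n = 4 * k + 4) \<or> (\<exists>k. n = 4 * k + 5)"
    by presburger
  then show ?thesis using that by (elim disjE exE) (auto simp: numeral_eq_Suc)
qed

text \<open>The partial quotients of \<open>\<surd>D\<close>; those of \<open>- \<surd>D\<close> are their negatives.\<close>

definition sqrt_quotient :: "nat \<Rightarrow> nat \<Rightarrow> nat \<Rightarrow> rat" where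
  "sqrt_quotient p m = eventually_periodic [0, 1 / of_nat p]
     [-1, - (2 * (of_nat p ^ (m - 1) - 1) / ((of_nat p - 1) * of_nat p ^ (m - 1))),
      -1, 2 / of_nat p]"

text \<open>
  The complete quotients in terms of \<open>X = (1 - p) \<surd>D / p\<close>, the square root of \<open>1 - p\<^sup>m\<close> congruent to
  \<open>1\<close>. In this coordinate every one of them is a quotient of factors whose norms can be read off.
\<close>

definition sqrt_complete :: "'p::prime_card padic \<Rightarrow> nat \<Rightarrow> 'p padic" where
  "sqrt_complete X = (let P = of_nat CARD('p) in
     eventually_periodic [P * X / (1 - P), (1 - P) / (P * X)]
       [P * X / (1 - X - P), (1 - X - P) / ((1 - P) * (1 - X)),
        (1 + X) * (1 - P) / (P - 1 - X), (1 + X - P) / (P * X)])"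

lemma sqrt_complete_0:
  "sqrt_complete X 0 = of_nat CARD('p) * X / (1 - of_nat CARD('p))" for X :: "'p::prime_card padic"
  by (simp add: sqrt_complete_def Let_def eventually_periodic_2_4)

context
  fixes X :: "'p::prime_card padic" and m :: nat
  assumes odd_p: "odd CARD('p)"
    and m_ge_2: "m \<ge> 2"
    and X_sq: "X\<^sup>2 = 1 - of_nat CARD('p) ^ m"
    and X_near: "padic_norm (X - 1) < 1"
begin

lemmas p_ge_3 = odd_prime_ge_3[OF prime_card odd_p]
lemmas norm_X = padic_norm_one_unit[OF X_near]
lemmas norm_1_plus_X = padic_norm_1_plus_one_unit[OF odd_p X_near]

text \<open>
  The conjugate factor \<open>1 + X\<close> is a unit, so \<open>1 - X\<close> carries the full power of \<open>p\<close>.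
\<close>

lemma factorization: "(1 - X) * (1 + X) = of_nat CARD('p) ^ m"
  using X_sq by (simp add: algebra_simps power2_eq_square)

lemma norm_1_minus_X: "padic_norm (1 - X) = (1 / real CARD('p)) ^ m"
  using arg_cong[OF factorization, of padic_norm]
  by (simp add: padic_norm_mult padic_norm_power padic_norm_prime norm_1_plus_X)

lemma norm_1_minus_X_minus_p: "padic_norm (1 - X - of_nat CARD('p)) = 1 / real CARD('p)"
proof -
  have "(1 / real CARD('p)) ^ m < (1 / real CARD('p)) ^ 1"
    using p_ge_3 m_ge_2 by (intro power_strict_decreasing) auto
  then have "padic_norm (1 - X) < padic_norm (of_nat CARD('p) :: 'p padic)"
    by (simp only: norm_1_minus_X padic_norm_prime power_one_right)
  then show ?thesis
    using padic_norm_diff_eq[of "1 - X" "of_nat CARD('p)"]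
      padic_norm_diff_commute[of "1 - X" "of_nat CARD('p)"] by (simp add: padic_norm_prime)
qed

lemma norm_p_minus_1_minus_X: "padic_norm (of_nat CARD('p) - 1 - X) = 1"
proof -
  have "padic_norm ((1 + X) - of_nat CARD('p)) = 1"
    using padic_norm_diff_eq[of "of_nat CARD('p)" "1 + X"] padic_norm_prime_less_1[where 'p = 'p] norm_1_plus_X by simp
  moreover have "of_nat CARD('p) - 1 - X = - ((1 + X) - of_nat CARD('p))" by simp
  ultimately show ?thesis by (simp only: padic_norm_minus)
qed

lemmas norms = padic_norm_1_minus_prime[where 'p = 'p] norm_X norm_1_plus_X norm_1_minus_X norm_1_minus_X_minus_p
  norm_p_minus_1_minus_X padic_norm_prime[where 'p = 'p]

lemma nonzero:
  "of_nat CARD('p) \<noteq> (0 :: 'p padic)" "1 - of_nat CARD('p) \<noteq> (0 :: 'p padic)" "X \<noteq> 0" "1 + X \<noteq> 0"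
  "1 - X \<noteq> 0" "1 - X - of_nat CARD('p) \<noteq> 0" "of_nat CARD('p) - 1 - X \<noteq> 0"
  using norms p_ge_3 by (auto simp flip: padic_norm_eq_0_iff)

text \<open>
  These identities are the computation of the expansion. Only the second entry of the period uses the
  equation for \<open>X\<close>, in the form \<open>P / (1 - X) = (1 + X) / Q\<close>.
\<close>

lemma sqrt_complete_rec: "sqrt_complete X n = of_rat (sqrt_quotient CARD('p) m n) + 1 / sqrt_complete X (Suc n)"
proof -
  define P :: "'p padic" where "P = of_nat CARD('p)"
  define Q where "Q = P ^ (m - 1)"
  note nz = nonzero[folded P_def]
  have Q0: "Q \<noteq> 0" using nz by (simp add: Q_def)
  have fac: "(1 - X) * (1 + X) = P * Q"
    using factorization m_ge_2 power_minus_mult[of m P] by (simp add: P_def Q_def mult.commute)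
  have PY: "P / (1 - X) = (1 + X) / Q" "P / (1 + X) = (1 - X) / Q"
    using fac nz Q0 by (simp_all add: field_simps)
  have 0: "P * X / (1 - P) = 0 + 1 / ((1 - P) / (P * X))" by simp
  have 1: "(1 - P) / (P * X) = 1 / P + 1 / (P * X / (1 - X - P))"
    using nz by (simp add: field_simps)
  have 2: "P * X / (1 - X - P) = - 1 + 1 / ((1 - X - P) / ((1 - P) * (1 - X)))"
    using nz by (simp add: field_simps)
  have 3: "(1 - X - P) / ((1 - P) * (1 - X)) =
    - (2 * (Q - 1) / ((P - 1) * Q)) + 1 / ((1 + X) * (1 - P) / (P - 1 - X))"
  proof -
    have "(1 - X - P) / ((1 - P) * (1 - X)) = (1 - P / (1 - X)) / (1 - P)"
      using nz by (simp add: field_simps)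
    also have "\<dots> = (2 - 2 / Q + (P / (1 + X) - 1)) / (1 - P)"
      unfolding PY by (simp add: diff_divide_distrib add_divide_distrib)
    also have "\<dots> = (2 - 2 / Q) / (1 - P) + (P / (1 + X) - 1) / (1 - P)"
      by (rule add_divide_distrib)
    also have "(2 - 2 / Q) / (1 - P) = - (2 * (Q - 1) / ((P - 1) * Q))"
    proof -
      have "P - 1 = - (1 - P)" by simp
      then show ?thesis using nz Q0 by (simp only: mult_minus_left divide_minus_right) (simp add: field_simps)
    qed
    also have "(P / (1 + X) - 1) / (1 - P) = 1 / ((1 + X) * (1 - P) / (P - 1 - X))"
      using nz by (simp add: field_simps)
    finally show ?thesis .
  qed
  have 4: "(1 + X) * (1 - P) / (P - 1 - X) = - 1 + 1 / ((1 + X - P) / (P * X))"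
  proof -
    define Z where "Z = P - 1 - X"
    have "Z \<noteq> 0" using nz by (simp add: Z_def)
    moreover have "(1 + X) * (1 - P) = - Z - P * X" by (simp add: Z_def algebra_simps)
    moreover have "1 + X - P = - Z" by (simp add: Z_def)
    ultimately show ?thesis unfolding Z_def[symmetric] by (simp add: diff_divide_distrib)
  qed
  have 5: "(1 + X - P) / (P * X) = 2 / P + 1 / (P * X / (1 - X - P))"
    using nz by (simp add: field_simps)
  show ?thesis
    by (cases n rule: cases_2_4;
        simp only: sqrt_complete_def sqrt_quotient_def Let_def eventually_periodic_2_4 P_def[symmetric];
        simp only: of_rat_0 of_rat_1 of_rat_minus of_rat_divide of_rat_mult of_rat_diff of_rat_power
          of_rat_of_nat_eq of_rat_numeral_eq P_def[symmetric] Q_def[symmetric];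
        rule 0 1 2 3 4 5)
qed

text \<open>
  The errors \<open>\<alpha>\<^sub>n - b\<^sub>n\<close> are the inverses of these complete quotients. They have norm at most \<open>1 / p\<close>
  after an even step, as \<^const>\<open>browkin_s\<close> requires, and exactly \<open>1\<close> after an odd one, so that
  \<^const>\<open>browkin_t\<close> applies without the sign correction.
\<close>

lemma norm_sqrt_complete:
  "padic_norm (sqrt_complete X (Suc n)) = 1 \<and> odd n \<or> padic_norm (sqrt_complete X (Suc n)) \<ge> real CARD('p) \<and> even n"
proof -
  have norm': "padic_norm (1 + X - of_nat CARD('p)) = 1"
    using norm_p_minus_1_minus_X padic_norm_minus[of "of_nat CARD('p) - 1 - X"]
    by (simp add: algebra_simps)
  have third: "real CARD('p) \<le> 1 / real CARD('p) / (1 / real CARD('p)) ^ m"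
  proof -
    have "(1 / real CARD('p)) ^ m \<le> (1 / real CARD('p))\<^sup>2"
      using p_ge_3 m_ge_2 by (intro power_decreasing) auto
    then have "1 / real CARD('p) / (1 / real CARD('p))\<^sup>2 \<le> 1 / real CARD('p) / (1 / real CARD('p)) ^ m"
      using p_ge_3 by (intro divide_left_mono) auto
    then show ?thesis using p_ge_3 by (simp add: power2_eq_square)
  qed
  show ?thesis
    by (cases n rule: cases_2_4;
        simp only: sqrt_complete_def Let_def eventually_periodic_2_4 padic_norm_divide padic_norm_mult
          norms norm' mult_1_left mult_1_right div_by_1)
      (use third p_ge_3 in \<open>auto simp del: power_Suc\<close>)
qed

lemma cfrac_value_sqrt_quotient:
  assumes "\<epsilon> = 1 \<or> \<epsilon> = - 1"
  shows "cfrac_value (\<lambda>n. \<epsilon> * sqrt_quotient CARD('p) m n) (of_rat \<epsilon> * sqrt_complete X 0)"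
proof -
  have \<epsilon>: "of_rat \<epsilon> = (1 :: 'p padic) \<or> of_rat \<epsilon> = (- 1 :: 'p padic)"
    using assms by (auto simp: of_rat_minus)
  have rec: "of_rat \<epsilon> * sqrt_complete X n = of_rat (\<epsilon> * sqrt_quotient CARD('p) m n) + 1 / (of_rat \<epsilon> * sqrt_complete X (Suc n))" for n
    using \<epsilon> sqrt_complete_rec[of n] by (auto simp: of_rat_mult)
  have norm: "padic_norm (of_rat \<epsilon> * sqrt_complete X n) = padic_norm (sqrt_complete X n)" for n
    using \<epsilon> by (auto simp: padic_norm_minus)
  have grow: "real CARD('p) \<le> padic_norm (of_rat \<epsilon> * sqrt_complete X (Suc n)) * padic_norm (of_rat \<epsilon> * sqrt_complete X (Suc (Suc n)))" for n
    unfolding norm using norm_sqrt_complete[of n] norm_sqrt_complete[of "Suc n"] by auto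
  show ?thesis
    by (rule cfrac_value_of_complete_quotients[where \<alpha> = "\<lambda>n. of_rat \<epsilon> * sqrt_complete X n", OF rec grow])
      (use p_ge_3 in simp)
qed

text \<open>The long entry of the period lies in \<open>\<int>[1/p]\<close> because the geometric sum cancels \<open>p - 1\<close>.\<close>

lemma sqrt_quotient_integral: "sqrt_quotient CARD('p) m n * of_nat CARD('p) ^ (m - 1) \<in> \<int>"
proof -
  let ?p = "of_nat CARD('p) :: rat"
  have p0: "?p \<noteq> 0" and p1: "?p - 1 \<noteq> 0" using p_ge_3 by auto
  have "?p ^ (m - 1) - 1 = (?p - 1) * (\<Sum>i<m - 1. ?p ^ i)"
    by (rule power_diff_1_eq)
  then have "2 * (?p ^ (m - 1) - 1) / ((?p - 1) * ?p ^ (m - 1)) * ?p ^ (m - 1) = 2 * (\<Sum>i<m - 1. ?p ^ i)"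
    using p0 p1 by simp
  also have "\<dots> \<in> \<int>" by (intro Ints_mult Ints_sum Ints_power) auto
  finally have "- (2 * (?p ^ (m - 1) - 1) / ((?p - 1) * ?p ^ (m - 1)) * ?p ^ (m - 1)) \<in> \<int>"
    by (rule Ints_minus)
  then have long: "- (2 * (?p ^ (m - 1) - 1) / ((?p - 1) * ?p ^ (m - 1))) * ?p ^ (m - 1) \<in> \<int>"
    by (simp only: mult_minus_left)
  have pole: "c / ?p * ?p ^ (m - 1) \<in> \<int>" if "c \<in> \<int>" for c
  proof -
    have "?p ^ (m - 1) = ?p * ?p ^ (m - 2)"
      using m_ge_2 by (simp flip: power_Suc add: Suc_diff_Suc numeral_2_eq_2)
    then have "c / ?p * ?p ^ (m - 1) = c * ?p ^ (m - 2)" using p0 by simp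
    also have "\<dots> \<in> \<int>" using that by (intro Ints_mult Ints_power) auto
    finally show ?thesis .
  qed
  show ?thesis
    by (cases n rule: cases_2_4;
        simp only: sqrt_quotient_def eventually_periodic_2_4 long pole[OF Ints_1] pole[OF Ints_numeral])
      simp_all
qed

text \<open>
  For \<open>p = 3\<close> the partial quotient \<open>2 / p\<close> exceeds one half, so \<open>2\<close> is not a balanced digit and
  \<^const>\<open>browkin_t\<close> cannot return it. For \<open>p \<ge> 5\<close> the factor \<open>p - 1 \<ge> 4\<close> is just large enough
  for the quotient with the geometric sum.
\<close>

lemma sqrt_quotient_small:
  assumes "CARD('p) \<noteq> 3"
  shows "2 * \<bar>sqrt_quotient CARD('p) m n\<bar> < (if even n then of_nat CARD('p) else 1)"
proof -
  let ?p = "of_nat CARD('p) :: rat"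
  have "CARD('p) \<noteq> 4" using odd_p by auto
  then have "CARD('p) \<ge> 5" using assms p_ge_3 by linarith
  then have p5: "?p \<ge> 5" by (metis of_nat_le_iff of_nat_numeral)
  have Q: "?p ^ (m - 1) \<ge> 1" using p5 by (intro one_le_power) simp
  have "4 * (?p ^ (m - 1) - 1) < 4 * ?p ^ (m - 1)" by simp
  also have "\<dots> \<le> (?p - 1) * ?p ^ (m - 1)" using p5 Q by (intro mult_right_mono) auto
  finally have "2 * (2 * (?p ^ (m - 1) - 1) / ((?p - 1) * ?p ^ (m - 1))) < 1"
    using p5 Q by (simp add: divide_less_eq del: power_Suc)
  moreover have "2 * (?p ^ (m - 1) - 1) / ((?p - 1) * ?p ^ (m - 1)) \<ge> 0"
    using p5 Q by (intro divide_nonneg_nonneg mult_nonneg_nonneg) auto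
  ultimately have B: "2 * \<bar>- (2 * (?p ^ (m - 1) - 1) / ((?p - 1) * ?p ^ (m - 1)))\<bar> < 1"
    by (simp only: abs_minus_cancel abs_of_nonneg)
  show ?thesis
    by (cases n rule: cases_2_4; simp only: sqrt_quotient_def eventually_periodic_2_4)
      (use B p5 in \<open>auto simp: field_simps simp del: power_Suc\<close>)
qed

lemma browkin2_sqrt_quotient:
  assumes "\<epsilon> = 1 \<or> \<epsilon> = - 1" "CARD('p) \<noteq> 3"
  shows "browkin2 (of_rat \<epsilon> * sqrt_complete X 0) n = Some (\<epsilon> * sqrt_quotient CARD('p) m n)"
proof -
  have \<epsilon>: "of_rat \<epsilon> = (1 :: 'p padic) \<or> of_rat \<epsilon> = (- 1 :: 'p padic)"
    using assms by (auto simp: of_rat_minus)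
  have rec: "of_rat \<epsilon> * sqrt_complete X n = of_rat (\<epsilon> * sqrt_quotient CARD('p) m n) + 1 / (of_rat \<epsilon> * sqrt_complete X (Suc n))" for n
    using \<epsilon> sqrt_complete_rec[of n] by (auto simp: of_rat_mult)
  have nz: "of_rat \<epsilon> * sqrt_complete X (Suc n) \<noteq> 0" for n
    using \<epsilon> norm_sqrt_complete[of n] p_ge_3 by auto
  have quot: "browkin2_quotient n (of_rat \<epsilon> * sqrt_complete X n) = \<epsilon> * sqrt_quotient CARD('p) m n" for n
  proof -
    have "of_rat \<epsilon> * sqrt_complete X n - of_rat (\<epsilon> * sqrt_quotient CARD('p) m n) = 1 / (of_rat \<epsilon> * sqrt_complete X (Suc n))"
      using rec[of n] by simp
    then have diff: "padic_norm (of_rat \<epsilon> * sqrt_complete X n - of_rat (\<epsilon> * sqrt_quotient CARD('p) m n)) = 1 / padic_norm (sqrt_complete X (Suc n))"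
      using \<epsilon> by (auto simp: padic_norm_divide padic_norm_minus)
    have int: "\<epsilon> * sqrt_quotient CARD('p) m n * of_nat CARD('p) ^ (m - 1) \<in> \<int>"
      using sqrt_quotient_integral[of n] assms(1) by auto
    have small: "2 * \<bar>\<epsilon> * sqrt_quotient CARD('p) m n\<bar> < (if even n then of_nat CARD('p) else 1)"
      using sqrt_quotient_small[OF assms(2), of n] assms(1) by auto
    show ?thesis
    proof (cases "even n")
      case True
      have "1 / padic_norm (sqrt_complete X (Suc n)) \<le> 1 / real CARD('p)"
        using norm_sqrt_complete[of n] True p_ge_3 by (intro divide_left_mono) auto
      then have "browkin_s (of_rat \<epsilon> * sqrt_complete X n) = \<epsilon> * sqrt_quotient CARD('p) m n"
        using True small diff by (intro browkin_s_eqI[OF odd_p int]) auto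
      then show ?thesis using True by (simp add: browkin2_quotient_def)
    next
      case False
      then have norm1: "padic_norm (of_rat \<epsilon> * sqrt_complete X n - of_rat (\<epsilon> * sqrt_quotient CARD('p) m n)) = 1"
        using norm_sqrt_complete[of n] diff by simp
      then have "browkin_t (of_rat \<epsilon> * sqrt_complete X n) = \<epsilon> * sqrt_quotient CARD('p) m n"
        using False small by (intro browkin_t_eqI[OF odd_p int]) auto
      moreover have "padic_val (of_rat \<epsilon> * sqrt_complete X n - of_rat (\<epsilon> * sqrt_quotient CARD('p) m n)) = 0"
        using norm1 by (auto simp: padic_val_def zero_ereal_def)
      ultimately show ?thesis using False by (simp add: browkin2_quotient_def)
    qed
  qed
  show ?thesis
    using browkin2_eq_Some[where \<alpha> = "\<lambda>n. of_rat \<epsilon> * sqrt_complete X n", OF rec nz quot] .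
qed

end

theorem theorem16:
  fixes p m :: nat and D :: "'p::prime_card padic"
  assumes "p = CARD('p)" and "odd p" and "m \<ge> 2"
    and "D = (1 - of_nat p ^ m) / (1 - of_nat p)\<^sup>2 * of_nat p ^ 2"
  shows "(\<exists>!\<delta>. \<delta>\<^sup>2 = D \<and> padic_val (\<delta> - of_nat p) \<ge> 2) \<and>
    (\<forall>\<delta>. \<delta>\<^sup>2 = D \<and> padic_val (\<delta> - of_nat p) \<ge> 2 \<longrightarrow>
      (\<forall>\<epsilon>\<in>{1, -1 :: rat}.
        let b = eventually_periodic
              [0, \<epsilon> * (1 / of_nat p)]
              [- \<epsilon>, - \<epsilon> * (2 * (of_nat p ^ (m - 1) - 1) / ((of_nat p - 1) * of_nat p ^ (m - 1))),
               - \<epsilon>, \<epsilon> * (2 / of_nat p)]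
        in cfrac_value b (of_rat \<epsilon> * \<delta>) \<and>
           (p \<noteq> 3 \<longrightarrow> (\<forall>n. browkin2 (of_rat \<epsilon> * \<delta>) n = Some (b n)))))"
proof -
  have odd: "odd CARD('p)" using assms(1,2) by simp
  define P :: "'p padic" where "P = of_nat CARD('p)"
  have normP: "padic_norm P = 1 / real p" by (simp add: P_def padic_norm_prime assms(1))
  have p1: "real p > 1" unfolding assms(1) by (rule p_gt_1[OF prime_card])
  have norm1P: "padic_norm (1 - P) = 1" by (simp add: P_def padic_norm_1_minus_prime)
  have nz: "P \<noteq> 0" "1 - P \<noteq> 0" using normP norm1P p1 by auto
  have D: "D = (1 - P ^ m) / (1 - P)\<^sup>2 * P\<^sup>2" by (simp add: assms(1,4) P_def)
  \<comment> \<open>The substitution \<open>\<delta> = P X / (1 - P)\<close> turns roots of \<open>D\<close> near \<open>P\<close> into roots of \<open>1 - P ^ m\<close> near \<open>1\<close>.\<close>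
  have to_unit: "((1 - P) * \<delta> / P)\<^sup>2 = 1 - P ^ m \<and> padic_norm ((1 - P) * \<delta> / P - 1) < 1"
    if \<delta>: "\<delta>\<^sup>2 = D" "padic_val (\<delta> - P) \<ge> 2" for \<delta>
  proof
    show "((1 - P) * \<delta> / P)\<^sup>2 = 1 - P ^ m"
      using nz \<delta>(1) by (simp add: D power_divide power_mult_distrib)
    have near: "padic_norm (\<delta> - P) \<le> (1 / real p)\<^sup>2"
      using padic_val_ge_2_iff[THEN iffD1, OF \<delta>(2)] by (simp only: assms(1))
    also have "\<dots> < 1 / real p" using p1 by (simp add: power2_eq_square field_simps)
    finally have less: "padic_norm (\<delta> - P) < 1 / real p" .
    then have "padic_norm \<delta> = 1 / real p"
      using padic_norm_add_eq[of "\<delta> - P" P] normP by simp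
    then have "padic_norm (P * \<delta>) = 1 / real p * (1 / real p)"
      using normP by (simp add: padic_norm_mult)
    also have "\<dots> < 1 / real p" using p1 by (simp add: field_simps)
    finally have "padic_norm (P * \<delta>) < 1 / real p" .
    with less have "padic_norm ((\<delta> - P) - P * \<delta>) < 1 / real p"
      using padic_norm_ultra_diff[of "\<delta> - P" "P * \<delta>"] by linarith
    moreover have "(1 - P) * \<delta> / P - 1 = ((\<delta> - P) - P * \<delta>) / P"
      using nz by (simp add: field_simps)
    ultimately show "padic_norm ((1 - P) * \<delta> / P - 1) < 1"
      using p1 by (simp add: padic_norm_divide normP field_simps)
  qed
  have ex: "\<exists>\<delta>. \<delta>\<^sup>2 = D \<and> padic_val (\<delta> - P) \<ge> 2"
  proof -
    have "rat_abs CARD('p) (1 - of_nat p ^ m - 1) < 1"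
      using p1 assms(3) rat_abs_minus[OF prime_card[where 'a = 'p], of "of_nat p ^ m"]
      by (simp add: assms(1) rat_abs_power[OF prime_card] rat_abs_prime[OF prime_card] power_one_over)
    from one_unit_has_sqrt[OF odd this]
    obtain X :: "'p padic" where X: "X\<^sup>2 = 1 - P ^ m" "padic_norm (X - 1) < 1"
      by (auto simp: of_rat_diff of_rat_power P_def assms(1))
    have "padic_norm (1 - X) = (1 / real p) ^ m"
      using norm_1_minus_X[OF odd assms(3)] X unfolding P_def assms(1) by simp
    moreover have "(1 / real p) ^ m \<le> (1 / real p)\<^sup>2"
      using p1 assms(3) by (intro power_decreasing) auto
    ultimately have "padic_norm (X - 1) \<le> (1 / real p)\<^sup>2"
      using padic_norm_diff_commute[of X 1] by simp
    also have "\<dots> \<le> 1 / real p" using p1 by (simp add: power2_eq_square field_simps)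
    finally have XP: "padic_norm ((X - 1) + P) \<le> 1 / real p"
      using padic_norm_ultra[of "X - 1" P] normP by simp
    have "P * X / (1 - P) - P = P * ((X - 1) + P) / (1 - P)"
      using nz by (simp add: field_simps)
    then have "padic_norm (P * X / (1 - P) - P) = 1 / real p * padic_norm ((X - 1) + P)"
      by (simp only: padic_norm_divide padic_norm_mult normP norm1P div_by_1)
    then have "padic_norm (P * X / (1 - P) - P) \<le> (1 / real p)\<^sup>2"
      using divide_right_mono[OF XP, of "real p"] by (simp add: power2_eq_square)
    moreover have "(P * X / (1 - P))\<^sup>2 = D"
      using X(1) by (simp add: D power_divide power_mult_distrib)
    ultimately show ?thesis using padic_val_ge_2_iff[THEN iffD2] unfolding assms(1) by blast
  qed
  have uniq: "\<delta> = \<delta>'" if "\<delta>\<^sup>2 = D \<and> padic_val (\<delta> - P) \<ge> 2" "\<delta>'\<^sup>2 = D \<and> padic_val (\<delta>' - P) \<ge> 2" for \<delta> \<delta>'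
  proof -
    define X X' where "X = (1 - P) * \<delta> / P" and "X' = (1 - P) * \<delta>' / P"
    have X: "X\<^sup>2 = 1 - P ^ m" "padic_norm (X - 1) < 1" and X': "X'\<^sup>2 = 1 - P ^ m" "padic_norm (X' - 1) < 1"
      using to_unit that unfolding X_def X'_def by auto
    have "X \<noteq> - X'"
    proof
      assume "X = - X'"
      then have "padic_norm (1 + X) < 1"
        using X'(2) padic_norm_diff_commute[of X' 1] by simp
      moreover have "padic_norm (1 + X) = 1"
        using padic_norm_1_plus_one_unit[OF odd] X by simp
      ultimately show False by simp
    qed
    then have "X = X'" using X(1) X'(1) power2_eq_iff[of X X'] by simp
    then show ?thesis using nz by (simp add: X_def X'_def)
  qed
  show ?thesis
  proof (intro conjI allI impI ballI)
    show "\<exists>!\<delta>. \<delta>\<^sup>2 = D \<and> padic_val (\<delta> - of_nat p) \<ge> 2"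
      using ex uniq unfolding P_def assms(1) by blast
  next
    fix \<delta> and \<epsilon> :: rat
    assume \<delta>: "\<delta>\<^sup>2 = D \<and> padic_val (\<delta> - of_nat p) \<ge> 2" and "\<epsilon> \<in> {1, - 1}"
    then have \<epsilon>: "\<epsilon> = 1 \<or> \<epsilon> = - 1" by simp
    define X where "X = (1 - P) * \<delta> / P"
    have X: "X\<^sup>2 = 1 - of_nat CARD('p) ^ m" "padic_norm (X - 1) < 1"
      using to_unit[of \<delta>] \<delta> unfolding X_def P_def assms(1) by auto
    have start: "sqrt_complete X 0 = \<delta>"
      using nz by (simp add: sqrt_complete_0 X_def P_def)
    define b where "b = eventually_periodic
              [0, \<epsilon> * (1 / of_nat p)]
              [- \<epsilon>, - \<epsilon> * (2 * (of_nat p ^ (m - 1) - 1) / ((of_nat p - 1) * of_nat p ^ (m - 1))),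
               - \<epsilon>, \<epsilon> * (2 / of_nat p)]"
    have "b = (\<lambda>n. \<epsilon> * sqrt_quotient p m n)"
      unfolding b_def sqrt_quotient_def
      by (subst eventually_periodic_map[symmetric]) auto
    then have "cfrac_value b (of_rat \<epsilon> * \<delta>) \<and> (p \<noteq> 3 \<longrightarrow> (\<forall>n. browkin2 (of_rat \<epsilon> * \<delta>) n = Some (b n)))"
      using cfrac_value_sqrt_quotient[OF odd assms(3) X \<epsilon>]
        browkin2_sqrt_quotient[OF odd assms(3) X \<epsilon>] start assms(1) by simp
    then show "let b = eventually_periodic
              [0, \<epsilon> * (1 / of_nat p)]
              [- \<epsilon>, - \<epsilon> * (2 * (of_nat p ^ (m - 1) - 1) / ((of_nat p - 1) * of_nat p ^ (m - 1))),
               - \<epsilon>, \<epsilon> * (2 / of_nat p)]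
        in cfrac_value b (of_rat \<epsilon> * \<delta>) \<and>
           (p \<noteq> 3 \<longrightarrow> (\<forall>n. browkin2 (of_rat \<epsilon> * \<delta>) n = Some (b n)))"
      unfolding b_def Let_def .
  qed
qed

end
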